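(* Let $\Omega=\mathbb{R}^d/\mathbb{Z}^d$, let $h:\Omega\to\mathbb{R}$ be continuous, and let $\mathcal{M}$ be the real vector space of signed measures on $\Omega$ with bounded total variation. The mapping $\mathcal{N}_h:\mathcal{M}\to[0,\infty)$, $\mathcal{N}_h(\mu)=\|h\star\mu\|_{L^2(\Omega)}$, defines a norm on $\mathcal{M}$ if and only if all Fourier series coefficients $\hat h(\xi)$, $\xi\in\mathbb{Z}^d$, are nonzero.
   Context: $h\star\mu(x)=\int_\Omega h(x-y)\,d\mu(y)$ and $\hat h(\xi)=\int_\Omega e^{-2i\pi\langle\xi,x\rangle}h(x)\,dx$. *)

theory Defs
  imports "HOL-Analysis.Analysis"
begin

subsection \<open>The torus as a quotient of Euclidean space\<close>

definition int_translate :: "real ^ 'n \<Rightarrow> real ^ 'n \<Rightarrow> bool"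
  where "int_translate x y \<longleftrightarrow> (\<forall>i. x $ i - y $ i \<in> \<int>)"

lemma equivp_int_translate: "equivp int_translate"
proof (rule equivpI)
  show "reflp int_translate"
    by (auto simp: reflp_def int_translate_def)
  show "symp int_translate"
    unfolding symp_def int_translate_def by (metis Ints_minus minus_diff_eq)
  show "transp int_translate"
    unfolding transp_def int_translate_def
    by (metis Ints_add diff_add_cancel add_diff_eq)
qed

quotient_type (overloaded) 'n torus = "real ^ 'n::finite" / int_translate
  morphisms rep_torus to_torus
  by (rule equivp_int_translate)

instantiation torus :: (finite) ab_group_add
begin

lift_definition zero_torus :: "'a torus" is "0" .

lift_definition plus_torus :: "'a torus \<Rightarrow> 'a torus \<Rightarrow> 'a torus" is "(+)"
  unfolding int_translate_def vector_add_component add_diff_add by (metis Ints_add)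

lift_definition minus_torus :: "'a torus \<Rightarrow> 'a torus \<Rightarrow> 'a torus" is "(-)"
  unfolding int_translate_def
proof (intro allI)
  fix x x' y y' :: "real ^ 'a" and i
  assume "\<forall>i. x $ i - x' $ i \<in> \<int>" and "\<forall>i. y $ i - y' $ i \<in> \<int>"
  then have "(x $ i - x' $ i) - (y $ i - y' $ i) \<in> \<int>"
    by (meson Ints_diff)
  then show "(x - y) $ i - (x' - y') $ i \<in> \<int>"
    by (simp add: algebra_simps)
qed

lift_definition uminus_torus :: "'a torus \<Rightarrow> 'a torus" is "uminus"
  unfolding int_translate_def vector_uminus_component
  by (metis Ints_minus minus_diff_minus)

instance
  by standard (transfer, auto simp: int_translate_def)+

end

instantiation torus :: (finite) topological_space
begin

definition open_torus :: "'a torus set \<Rightarrow> bool"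
  where "open_torus U \<longleftrightarrow> open (to_torus -` U)"

instance
  by standard (auto simp: open_torus_def vimage_Union)

end

lemma continuous_on_to_torus: "continuous_on A to_torus"
  by (rule continuous_on_subset[of UNIV])
     (auto simp: continuous_on_open_vimage open_torus_def)

definition torus_measure :: "'n::finite torus measure"
  where "torus_measure =
    distr (restrict_space lborel {x. \<forall>i. 0 \<le> x $ i \<and> x $ i < 1}) borel to_torus"

lemma measurable_to_torus:
  "to_torus \<in> restrict_space lborel {x. \<forall>i. 0 \<le> x $ i \<and> x $ i < 1} \<rightarrow>\<^sub>M borel"
  using borel_measurable_continuous_onI[OF continuous_on_to_torus]
  by (intro measurable_restrict_space1) simp

text \<open>
  The function \<open>x \<mapsto> exp (- 2 \<i> \<pi> \<langle>\<xi>, x\<rangle>)\<close>; the pairing \<open>\<langle>\<xi>, x\<rangle>\<close> itself is only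
  defined modulo \<open>\<int>\<close> on the torus.
\<close>

lift_definition torus_char :: "int ^ 'n \<Rightarrow> 'n::finite torus \<Rightarrow> complex"
  is "\<lambda>\<xi> x. exp (- 2 * \<i> * of_real pi * of_real (\<Sum>i\<in>UNIV. of_int (\<xi> $ i) * x $ i))"
proof -
  fix \<xi> :: "int ^ 'n" and x y :: "real ^ 'n"
  assume "int_translate x y"
  then have "(\<Sum>i\<in>UNIV. of_int (\<xi> $ i) * (x $ i - y $ i)) \<in> \<int>"
    unfolding int_translate_def by (intro Ints_sum Ints_mult) auto
  then obtain k :: int where
    "(\<Sum>i\<in>UNIV. of_int (\<xi> $ i) * (x $ i - y $ i)) = of_int k"
    by (elim Ints_cases)
  then have k: "(\<Sum>i\<in>UNIV. of_int (\<xi> $ i) * x $ i) =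
      (\<Sum>i\<in>UNIV. of_int (\<xi> $ i) * y $ i) + of_int k"
    by (simp add: right_diff_distrib sum_subtractf)
  show "exp (- 2 * \<i> * of_real pi * of_real (\<Sum>i\<in>UNIV. of_int (\<xi> $ i) * x $ i)) =
      exp (- 2 * \<i> * of_real pi * of_real (\<Sum>i\<in>UNIV. of_int (\<xi> $ i) * y $ i))"
    unfolding k exp_eq by (intro exI[of _ "- k"]) (simp add: algebra_simps)
qed

definition fourier_coeff :: "('n::finite torus \<Rightarrow> real) \<Rightarrow> int ^ 'n \<Rightarrow> complex"
  where "fourier_coeff h \<xi> = (LINT x|torus_measure. torus_char \<xi> x * of_real (h x))"


subsection \<open>Signed Borel measures of bounded total variation\<close>

definition total_variation :: "('a::topological_space set \<Rightarrow> real) \<Rightarrow> ennreal"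
  where "total_variation \<mu> =
    (SUP P \<in> {P. finite P \<and> P \<subseteq> sets borel \<and> disjoint P}. \<Sum>A\<in>P. ennreal \<bar>\<mu> A\<bar>)"

lemma total_variation_zero: "total_variation (\<lambda>_. 0) = 0"
  unfolding total_variation_def by (intro antisym SUP_least) auto

definition is_signed_measure :: "('a::topological_space set \<Rightarrow> real) \<Rightarrow> bool"
  where "is_signed_measure \<mu> \<longleftrightarrow>
    \<mu> {} = 0 \<and>
    (\<forall>A :: nat \<Rightarrow> 'a set. range A \<subseteq> sets borel \<longrightarrow> disjoint_family A \<longrightarrow>
       (\<lambda>i. \<mu> (A i)) sums \<mu> (\<Union>i. A i))"

text \<open>
  The value \<open>0\<close> on non-Borel sets is a convention which makes equality of functions
  coincide with equality of signed measures.
\<close>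

typedef (overloaded) ('a::topological_space) signed_measure =
  "{\<mu> :: 'a set \<Rightarrow> real. is_signed_measure \<mu> \<and> total_variation \<mu> < \<infinity> \<and>
      (\<forall>A. A \<notin> sets borel \<longrightarrow> \<mu> A = 0)}"
  morphisms sm_value Abs_signed_measure
  by (rule exI[of _ "\<lambda>_. 0"]) (auto simp: is_signed_measure_def total_variation_zero)

setup_lifting type_definition_signed_measure

lemma is_signed_measure_add:
  "is_signed_measure \<mu> \<Longrightarrow> is_signed_measure \<nu> \<Longrightarrow> is_signed_measure (\<lambda>A. \<mu> A + \<nu> A)"
  unfolding is_signed_measure_def by (auto intro!: sums_add)

lemma is_signed_measure_scale:
  "is_signed_measure \<mu> \<Longrightarrow> is_signed_measure (\<lambda>A. c * \<mu> A)"
  unfolding is_signed_measure_def by (auto intro!: sums_mult)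

lemma total_variation_add: "total_variation (\<lambda>A. \<mu> A + \<nu> A) \<le> total_variation \<mu> + total_variation \<nu>"
  unfolding total_variation_def
proof (rule SUP_least)
  fix P :: "'a set set"
  assume P: "P \<in> {P. finite P \<and> P \<subseteq> sets borel \<and> disjoint P}"
  have "(\<Sum>A\<in>P. ennreal \<bar>\<mu> A + \<nu> A\<bar>) \<le> (\<Sum>A\<in>P. ennreal \<bar>\<mu> A\<bar> + ennreal \<bar>\<nu> A\<bar>)"
    by (intro sum_mono) (simp flip: ennreal_plus add: ennreal_leI abs_triangle_ineq)
  also have "\<dots> = (\<Sum>A\<in>P. ennreal \<bar>\<mu> A\<bar>) + (\<Sum>A\<in>P. ennreal \<bar>\<nu> A\<bar>)"
    by (simp add: sum.distrib)
  also have "\<dots> \<le> (SUP P \<in> {P. finite P \<and> P \<subseteq> sets borel \<and> disjoint P}. \<Sum>A\<in>P. ennreal \<bar>\<mu> A\<bar>) +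
      (SUP P \<in> {P. finite P \<and> P \<subseteq> sets borel \<and> disjoint P}. \<Sum>A\<in>P. ennreal \<bar>\<nu> A\<bar>)"
    by (intro add_mono SUP_upper P)
  finally show "(\<Sum>A\<in>P. ennreal \<bar>\<mu> A + \<nu> A\<bar>) \<le> \<dots>" .
qed

lemma total_variation_scale: "total_variation (\<lambda>A. c * \<mu> A) \<le> ennreal \<bar>c\<bar> * total_variation \<mu>"
  unfolding total_variation_def
proof (rule SUP_least)
  fix P :: "'a set set"
  assume P: "P \<in> {P. finite P \<and> P \<subseteq> sets borel \<and> disjoint P}"
  have "(\<Sum>A\<in>P. ennreal \<bar>c * \<mu> A\<bar>) = ennreal \<bar>c\<bar> * (\<Sum>A\<in>P. ennreal \<bar>\<mu> A\<bar>)"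
    by (simp add: abs_mult ennreal_mult sum_distrib_left del: sum_ennreal)
  also have "\<dots> \<le> ennreal \<bar>c\<bar> *
      (SUP P \<in> {P. finite P \<and> P \<subseteq> sets borel \<and> disjoint P}. \<Sum>A\<in>P. ennreal \<bar>\<mu> A\<bar>)"
    by (intro mult_left_mono SUP_upper P) simp
  finally show "(\<Sum>A\<in>P. ennreal \<bar>c * \<mu> A\<bar>) \<le> \<dots>" .
qed

lemma total_variation_add_finite:
  "total_variation \<mu> < \<infinity> \<Longrightarrow> total_variation \<nu> < \<infinity> \<Longrightarrow> total_variation (\<lambda>A. \<mu> A + \<nu> A) < \<infinity>"
  by (rule le_less_trans[OF total_variation_add]) simp

lemma total_variation_scale_finite:
  "total_variation \<mu> < \<infinity> \<Longrightarrow> total_variation (\<lambda>A. c * \<mu> A) < \<infinity>"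
  by (rule le_less_trans[OF total_variation_scale]) (simp add: ennreal_mult_less_top)

instantiation signed_measure :: (topological_space) real_vector
begin

lift_definition zero_signed_measure :: "'a signed_measure" is "\<lambda>_. 0"
  by (auto simp: is_signed_measure_def total_variation_zero)

lift_definition plus_signed_measure ::
  "'a signed_measure \<Rightarrow> 'a signed_measure \<Rightarrow> 'a signed_measure" is "\<lambda>\<mu> \<nu> A. \<mu> A + \<nu> A"
  by (simp add: is_signed_measure_add total_variation_add_finite[simplified])

lift_definition scaleR_signed_measure ::
  "real \<Rightarrow> 'a signed_measure \<Rightarrow> 'a signed_measure" is "\<lambda>c \<mu> A. c * \<mu> A"
  by (simp add: is_signed_measure_scale total_variation_scale_finite[simplified])

definition uminus_signed_measure :: "'a signed_measure \<Rightarrow> 'a signed_measure"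
  where "- \<mu> = (-1) *\<^sub>R (\<mu> :: 'a signed_measure)"

definition minus_signed_measure ::
  "'a signed_measure \<Rightarrow> 'a signed_measure \<Rightarrow> 'a signed_measure"
  where "\<mu> - \<nu> = \<mu> + (-1) *\<^sub>R (\<nu> :: 'a signed_measure)"

instance
  by standard
     (unfold uminus_signed_measure_def minus_signed_measure_def,
      (transfer, auto simp: algebra_simps)+)

end

text \<open>
  The positive part of the Jordan decomposition,
  \<open>\<mu>\<^sup>+ A = sup {\<mu> B | B \<subseteq> A Borel}\<close>. Negative values of \<open>\<mu> B\<close> are truncated to \<open>0\<close> by
  \<^const>\<open>ennreal\<close>, which is harmless because \<open>B = {}\<close> already contributes \<open>0\<close>.
\<close>

definition pos_part :: "'a::topological_space signed_measure \<Rightarrow> 'a measure"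
  where "pos_part \<mu> = measure_of UNIV (sets borel)
    (\<lambda>A. SUP B \<in> {B \<in> sets borel. B \<subseteq> A}. ennreal (sm_value \<mu> B))"

lemma space_pos_part [simp]: "space (pos_part \<mu>) = UNIV"
  by (simp add: pos_part_def space_measure_of_conv)

lemma sets_pos_part [simp, measurable_cong]: "sets (pos_part (\<mu> :: 'a::topological_space signed_measure)) = sets borel"
  using sets.sets_measure_of_eq[of "borel :: 'a measure"] by (simp add: pos_part_def)

lemma emeasure_pos_part:
  fixes \<mu> :: "'a::topological_space signed_measure"
  assumes "A \<in> sets borel"
  shows "emeasure (pos_part \<mu>) A = (SUP B \<in> {B \<in> sets borel. B \<subseteq> A}. ennreal (sm_value \<mu> B))"
proof -
  define \<nu> where "\<nu> = (\<lambda>A. SUP B \<in> {B \<in> sets borel. B \<subseteq> A}. ennreal (sm_value \<mu> B))"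
  have nu: "\<nu> A = (SUP B \<in> {B \<in> sets borel. B \<subseteq> A}. ennreal (sm_value \<mu> B))" for A
    by (simp add: \<nu>_def)
  have sm: "is_signed_measure (sm_value \<mu>)" using sm_value[of \<mu>] by simp
  have m0: "sm_value \<mu> {} = 0" using sm by (simp add: is_signed_measure_def)
  have ca: "(\<lambda>i. sm_value \<mu> (A i)) sums sm_value \<mu> (\<Union>i. A i)"
    if "range A \<subseteq> sets borel" "disjoint_family A" for A :: "nat \<Rightarrow> 'a set"
    using sm that unfolding is_signed_measure_def by blast
  have add: "sm_value \<mu> (A \<union> B) = sm_value \<mu> A + sm_value \<mu> B"
    if "A \<in> sets borel" "B \<in> sets borel" "A \<inter> B = {}" for A B
  proof -
    have "range (binaryset A B) \<subseteq> sets borel"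
      using that by (simp add: range_binaryset_eq)
    moreover have "disjoint_family (binaryset A B)"
      using that(3) by (auto simp: disjoint_family_on_def binaryset_def)
    ultimately show ?thesis
      using ca[of "binaryset A B"] binaryset_sums[of "sm_value \<mu>" A B, OF m0]
      unfolding UN_binaryset_eq by (blast intro: sums_unique2)
  qed
  have nuE: "\<exists>B\<in>sets borel. B \<subseteq> A \<and> ennreal (sm_value \<mu> B) = ennreal (sm_value \<mu> B') \<and> sm_value \<mu> B \<ge> 0"
    if "B' \<in> sets borel" "B' \<subseteq> A" for A B'
  proof (cases "sm_value \<mu> B' \<ge> 0")
    case False
    then show ?thesis by (intro bexI[of _ "{}"]) (simp_all add: m0 ennreal_neg)
  qed (use that in blast)
  have up: "ennreal (sm_value \<mu> B) \<le> \<nu> A" if "B \<in> sets borel" "B \<subseteq> A" for A B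
    unfolding \<nu>_def using that by (intro SUP_upper) auto
  have sup2: "\<nu> A + \<nu> B \<le> \<nu> (A \<union> B)" if "A \<inter> B = {}" for A B
  proof -
    have 1: "ennreal (sm_value \<mu> B1) + ennreal (sm_value \<mu> B2) \<le> \<nu> (A \<union> B)"
      if B: "B1 \<in> sets borel" "B1 \<subseteq> A" "B2 \<in> sets borel" "B2 \<subseteq> B" for B1 B2
    proof -
      obtain C1 where C1: "C1 \<in> sets borel" "C1 \<subseteq> A" "ennreal (sm_value \<mu> C1) = ennreal (sm_value \<mu> B1)" "sm_value \<mu> C1 \<ge> 0"
        using nuE[OF B(1,2)] by blast
      obtain C2 where C2: "C2 \<in> sets borel" "C2 \<subseteq> B" "ennreal (sm_value \<mu> C2) = ennreal (sm_value \<mu> B2)" "sm_value \<mu> C2 \<ge> 0"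
        using nuE[OF B(3,4)] by blast
      have "ennreal (sm_value \<mu> B1) + ennreal (sm_value \<mu> B2) = ennreal (sm_value \<mu> (C1 \<union> C2))"
        using C1 C2 \<open>A \<inter> B = {}\<close> by (subst add) auto
      also have "\<dots> \<le> \<nu> (A \<union> B)" using C1 C2 by (intro up) auto
      finally show ?thesis .
    qed
    have ne: "{B \<in> sets borel. B \<subseteq> A} \<noteq> {}" for A :: "'a set" by auto
    have 2: "ennreal (sm_value \<mu> B1) + \<nu> B \<le> \<nu> (A \<union> B)" if "B1 \<in> sets borel" "B1 \<subseteq> A" for B1
      unfolding nu[of B] ennreal_SUP_add_right[OF ne[of B]] using that by (intro SUP_least 1) auto
    have "\<nu> A + \<nu> B = (SUP B1 \<in> {B \<in> sets borel. B \<subseteq> A}. ennreal (sm_value \<mu> B1) + \<nu> B)"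
      unfolding nu[of A] by (rule ennreal_SUP_add_left[OF ne, symmetric])
    also have "\<dots> \<le> \<nu> (A \<union> B)"
      by (intro SUP_least 2) auto
    finally show ?thesis .
  qed
  have mono: "\<nu> A \<le> \<nu> B" if "A \<subseteq> B" for A B
    unfolding \<nu>_def using that by (intro SUP_subset_mono) auto
  have "countably_additive (sets borel) \<nu>"
    unfolding countably_additive_def
  proof (intro allI impI antisym)
    fix A :: "nat \<Rightarrow> 'a set"
    assume A: "range A \<subseteq> sets borel" "disjoint_family A"
    have fin: "(\<Sum>i<n. \<nu> (A i)) \<le> \<nu> (\<Union>i<n. A i)" for n
    proof (induction n)
      case (Suc n)
      have "(\<Sum>i<Suc n. \<nu> (A i)) \<le> \<nu> (\<Union>i<n. A i) + \<nu> (A n)"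
        using Suc by (simp add: add_right_mono)
      also have "\<dots> \<le> \<nu> ((\<Union>i<n. A i) \<union> A n)"
      proof (rule sup2)
        have "A i \<inter> A n = {}" if "i < n" for i
          using A(2) that by (simp add: disjoint_family_on_def)
        then show "(\<Union>i<n. A i) \<inter> A n = {}"
          by blast
      qed
      finally show ?case by (simp add: lessThan_Suc Un_commute)
    qed auto
    show "(\<Sum>i. \<nu> (A i)) \<le> \<nu> (\<Union>i. A i)"
      by (rule suminf_le_const[OF summableI]) (rule order_trans[OF fin mono], auto)
    show "\<nu> (\<Union>i. A i) \<le> (\<Sum>i. \<nu> (A i))"
      unfolding nu[of "\<Union>i. A i"]
    proof (rule SUP_least)
      fix B assume B: "B \<in> {B \<in> sets borel. B \<subseteq> (\<Union>i. A i)}"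
      have "(\<lambda>i. sm_value \<mu> (B \<inter> A i)) sums sm_value \<mu> (\<Union>i. B \<inter> A i)"
      proof (rule ca)
        show "range (\<lambda>i. B \<inter> A i) \<subseteq> sets borel"
          using A(1) B by auto
        show "disjoint_family (\<lambda>i. B \<inter> A i)"
          using A(2) unfolding disjoint_family_on_def by blast
      qed
      moreover have "(\<Union>i. B \<inter> A i) = B" using B by auto
      ultimately have "(\<lambda>n. \<Sum>i<n. sm_value \<mu> (B \<inter> A i)) \<longlonglongrightarrow> sm_value \<mu> B"
        by (simp only: sums_def)
      then have lim: "(\<lambda>n. ennreal (\<Sum>i<n. sm_value \<mu> (B \<inter> A i))) \<longlonglongrightarrow> ennreal (sm_value \<mu> B)"
        by (rule tendsto_ennrealI)
      have "ennreal (\<Sum>i<n. sm_value \<mu> (B \<inter> A i)) \<le> (\<Sum>i. \<nu> (A i))" for n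
      proof -
        have "ennreal (\<Sum>i<n. sm_value \<mu> (B \<inter> A i)) \<le> ennreal (\<Sum>i<n. max 0 (sm_value \<mu> (B \<inter> A i)))"
          by (intro ennreal_leI sum_mono) auto
        also have "\<dots> = (\<Sum>i<n. ennreal (max 0 (sm_value \<mu> (B \<inter> A i))))"
          by (rule sum_ennreal[symmetric]) simp
        also have "\<dots> \<le> (\<Sum>i<n. \<nu> (A i))"
          using A B by (intro sum_mono) (auto simp: ennreal_max_0 intro!: up)
        also have "\<dots> \<le> (\<Sum>i. \<nu> (A i))" by (intro sum_le_suminf) auto
        finally show ?thesis .
      qed
      then show "ennreal (sm_value \<mu> B) \<le> (\<Sum>i. \<nu> (A i))"
        by (intro LIMSEQ_le_const2[OF lim]) auto
    qed
  qed
  moreover have "positive (sets borel) \<nu>"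
    unfolding positive_def nu by (intro antisym SUP_least) (auto simp: m0)
  moreover have "sigma_algebra UNIV (sets (borel :: 'a measure))"
    using sets.sigma_algebra_axioms[of "borel :: 'a measure"] by simp
  moreover have "pos_part \<mu> = measure_of UNIV (sets borel) \<nu>"
    by (simp only: pos_part_def \<nu>_def)
  ultimately have "emeasure (pos_part \<mu>) A = \<nu> A"
    using assms by (simp only: emeasure_measure_of_sigma)
  then show ?thesis
    by (simp only: nu)
qed

definition neg_part :: "'a::topological_space signed_measure \<Rightarrow> 'a measure"
  where "neg_part \<mu> = pos_part (- \<mu>)"

definition signed_integral :: "'a::topological_space signed_measure \<Rightarrow> ('a \<Rightarrow> real) \<Rightarrow> real"
  where "signed_integral \<mu> f = (LINT y|pos_part \<mu>. f y) - (LINT y|neg_part \<mu>. f y)"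


subsection \<open>Convolution and the associated functional\<close>

definition torus_conv ::
  "('n::finite torus \<Rightarrow> real) \<Rightarrow> 'n torus signed_measure \<Rightarrow> 'n torus \<Rightarrow> real"
  where "torus_conv h \<mu> x = signed_integral \<mu> (\<lambda>y. h (x - y))"

definition torus_L2_norm :: "('n::finite torus \<Rightarrow> real) \<Rightarrow> real"
  where "torus_L2_norm f = sqrt (LINT x|torus_measure. (f x)\<^sup>2)"

definition conv_norm :: "('n::finite torus \<Rightarrow> real) \<Rightarrow> 'n torus signed_measure \<Rightarrow> real"
  where "conv_norm h \<mu> = torus_L2_norm (torus_conv h \<mu>)"

definition is_norm :: "('v::real_vector \<Rightarrow> real) \<Rightarrow> bool"
  where "is_norm N \<longleftrightarrow>
    (\<forall>v. 0 \<le> N v) \<and>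
    (\<forall>v. N v = 0 \<longleftrightarrow> v = 0) \<and>
    (\<forall>c v. N (c *\<^sub>R v) = \<bar>c\<bar> * N v) \<and>
    (\<forall>v w. N (v + w) \<le> N v + N w)"

end

theory Submission
  imports Defs
begin

text \<open>
  Convolution turns into a product on the Fourier side: the coefficient of \<open>h \<star> \<mu>\<close> at \<open>\<xi>\<close> is the
  product of the coefficients of \<open>h\<close> and \<open>\<mu>\<close>. If no coefficient of \<open>h\<close> vanishes and
  \<open>h \<star> \<mu> = 0\<close> almost everywhere, then all coefficients of \<open>\<mu>\<close> vanish, so that \<open>\<mu> = 0\<close> by density of
  the trigonometric polynomials among the continuous functions (Stone-Weierstrass). Conversely, if
  the coefficient of \<open>h\<close> at \<open>\<xi>\<close> vanishes, then \<open>h\<close> annihilates the measures with density the real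
  part and the imaginary part of the character \<open>\<xi>\<close>; these are not both zero, since the squares of
  the two densities add up to \<open>1\<close>. Homogeneity and the triangle inequality hold for every \<open>h\<close>.
\<close>

subsection \<open>The quotient map\<close>

lemma to_torus_eq_iff: "to_torus x = to_torus y \<longleftrightarrow> (\<forall>i. x $ i - y $ i \<in> \<int>)"
  using torus.abs_eq_iff[of x y] by (simp add: int_translate_def)

lemma borel_measurable_to_torus [measurable]: "to_torus \<in> borel_measurable borel"
  by (intro borel_measurable_continuous_onI continuous_on_to_torus)

text \<open>This is the universal property of the quotient topology: it moves continuity questions
  to Euclidean space.\<close>

lemma continuous_on_torus_iff:
  fixes f :: "'n::finite torus \<Rightarrow> 'b::topological_space"
  shows "continuous_on UNIV f \<longleftrightarrow> continuous_on UNIV (f \<circ> to_torus)"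
  by (simp add: continuous_on_open_vimage open_torus_def vimage_comp o_def)

lemma torus_surj: "\<exists>x. t = to_torus x"
  by (metis Quotient_torus Quotient_abs_rep)

lemma continuous_on_torus_diff:
  fixes h :: "'n::finite torus \<Rightarrow> 'b::topological_space"
  assumes "continuous_on UNIV h"
  shows "continuous_on UNIV (\<lambda>y. h (x - y))"
proof -
  obtain a where x: "x = to_torus a" using torus_surj by blast
  have "continuous_on UNIV (\<lambda>y. (h \<circ> to_torus) (a - y))"
    using assms unfolding continuous_on_torus_iff
    by (rule continuous_on_compose2) (auto intro!: continuous_intros)
  then show ?thesis
    unfolding continuous_on_torus_iff[of "\<lambda>y. h (x - y)"] by (simp add: x o_def minus_torus.abs_eq)
qed

subsection \<open>A Borel section of the quotient map\<close>

text \<open>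
  The section makes \<open>(x, y) \<mapsto> h (x - y)\<close> measurable for the product of the Borel algebras without
  appeal to second countability of the quotient topology.
\<close>

definition torus_section :: "'n::finite torus \<Rightarrow> real ^ 'n"
  where "torus_section t = (\<chi> i. frac (rep_torus t $ i))"

text \<open>The representative chosen by \<open>rep_torus\<close> is only known up to an integer
  vector, and \<open>frac\<close> removes exactly this ambiguity.\<close>

lemma torus_section_to_torus: "torus_section (to_torus x) $ i = frac (x $ i)"
proof -
  have "int_translate (rep_torus (to_torus x)) x"
    using torus.abs_eq_iff Quotient_rep_abs[OF Quotient_torus] equivp_reflp[OF equivp_int_translate]
    by blast
  then have "rep_torus (to_torus x) $ i - x $ i \<in> \<int>"
    by (simp add: int_translate_def)
  then obtain k where "rep_torus (to_torus x) $ i = x $ i + of_int k"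
    by (metis Ints_cases add.commute diff_add_cancel)
  then show ?thesis
    by (simp add: torus_section_def frac_def)
qed

lemma to_torus_section [simp]: "to_torus (torus_section t) = t"
proof -
  obtain x where t: "t = to_torus x" using torus_surj by blast
  show ?thesis
    unfolding t to_torus_eq_iff torus_section_to_torus by (simp add: frac_def)
qed

text \<open>A coordinate of the section jumps only where it vanishes. For
  \<open>0 < a \<le> 1\<close> the sublevel set therefore splits into an open set, where the
  coordinate lies strictly between \<open>0\<close> and \<open>a\<close>, and the closed set where
  it is \<open>0\<close>.\<close>

lemma borel_measurable_torus_section [measurable]:
  "torus_section \<in> borel_measurable (borel :: 'n::finite torus measure)"
proof -
  have "(\<lambda>t. torus_section t $ i) \<in> borel_measurable (borel :: 'n torus measure)" for i
    unfolding borel_measurable_iff_less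
  proof
    fix a :: real
    consider "a \<le> 0" | "a > 1" | "0 < a" "a \<le> 1" by linarith
    then show "{t \<in> space (borel :: 'n torus measure). torus_section t $ i < a} \<in> sets borel"
    proof cases
      case 1
      have "torus_section t $ i \<ge> 0" for t :: "'n torus"
        by (simp add: torus_section_def)
      with 1 have "{t :: 'n torus. torus_section t $ i < a} = {}"
        by (auto simp: not_less intro: order_trans)
      then show ?thesis by simp
    next
      case 2
      have "torus_section t $ i < 1" for t :: "'n torus"
        by (simp add: torus_section_def frac_lt_1)
      with 2 have "{t :: 'n torus. torus_section t $ i < a} = UNIV"
        by (auto intro: less_trans)
      then show ?thesis by simp
    next
      case 3
      let ?U = "{t :: 'n torus. 0 < torus_section t $ i \<and> torus_section t $ i < a}"
      let ?C = "{t :: 'n torus. torus_section t $ i \<noteq> 0}"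
      \<comment> \<open>The integer \<open>m\<close> is the floor of the coordinate; since
        \<open>a \<le> 1\<close>, the strips do not reach the next integer.\<close>
      have "to_torus -` ?U = (\<Union>m::int. {x. of_int m < x $ i \<and> x $ i < of_int m + a})"
      proof (safe; simp add: torus_section_to_torus)
        fix x :: "real ^ 'n" assume "x $ i \<notin> \<int>" "frac (x $ i) < a"
        then show "\<exists>m::int. of_int m < x $ i \<and> x $ i < of_int m + a"
          by (intro exI[of _ "\<lfloor>x $ i\<rfloor>"])
            (metis add.commute floor_add_int frac_def frac_gt_0_iff diff_gt_0_iff_gt less_diff_eq
              diff_less_eq)
      next
        fix x :: "real ^ 'n" and m :: int
        assume m: "of_int m < x $ i" "x $ i < of_int m + a"
        with 3 have "\<lfloor>x $ i\<rfloor> = m" by linarith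
        with m show "x $ i \<notin> \<int> \<and> frac (x $ i) < a"
          by (subst frac_gt_0_iff[symmetric]) (auto simp: frac_def)
      qed
      moreover have "open (\<Union>m::int. {x :: real ^ 'n. of_int m < x $ i \<and> x $ i < of_int m + a})"
        by (intro open_UN ballI open_Collect_conj open_Collect_less continuous_intros)
      ultimately have U: "open ?U"
        by (simp add: open_torus_def)
      have "to_torus -` ?C = - {x. x $ i \<in> \<int>}"
        by (auto simp: torus_section_to_torus frac_eq_0_iff)
      moreover have "closed {x :: real ^ 'n. x $ i \<in> \<int>}"
        using closed_vimage[OF closed_Ints, of "\<lambda>x :: real ^ 'n. x $ i"]
        by (simp add: vimage_def continuous_on_component)
      ultimately have C: "open ?C"
        by (simp add: open_torus_def open_Compl)
      have "{t :: 'n torus. torus_section t $ i < a} = ?U \<union> (- ?C)"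
        using 3 by (auto simp: torus_section_def less_le frac_eq_0_iff[THEN iffD2])
      also have "\<dots> \<in> sets borel"
        by (intro sets.Un borel_open borel_comp U C)
      finally show ?thesis by simp
    qed
  qed
  then show ?thesis
    by (subst borel_measurable_euclidean_space) (auto simp: Basis_vec_def cart_eq_inner_axis)
qed

lemma borel_measurable_torus_diff:
  fixes h :: "'n::finite torus \<Rightarrow> 'b::topological_space"
  assumes "h \<in> borel_measurable borel"
  shows "(\<lambda>(x, y). h (x - y)) \<in> borel_measurable (borel \<Otimes>\<^sub>M borel)"
proof -
  note assms [measurable]
  have "(\<lambda>(x :: 'n torus, y). h (to_torus (torus_section x - torus_section y)))
      \<in> borel_measurable (borel \<Otimes>\<^sub>M borel)"
    by measurable
  then show ?thesis
    by (simp flip: minus_torus.abs_eq)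
qed

subsection \<open>Invariance of the torus measure\<close>

abbreviation int_vec :: "int ^ 'n \<Rightarrow> real ^ 'n::finite"
  where "int_vec k \<equiv> (\<chi> i. of_int (k $ i))"

abbreviation unit_cell :: "(real ^ 'n::finite) set"
  where "unit_cell \<equiv> {x. \<forall>i. 0 \<le> x $ i \<and> x $ i < 1}"

lemma to_torus_add_int_vec [simp]: "to_torus (x + int_vec k) = to_torus x"
  by (simp add: to_torus_eq_iff)

lemma unit_cell_translate: "\<exists>!k. x + int_vec k \<in> unit_cell"
proof (rule ex1I)
  show "x + int_vec (\<chi> i. - \<lfloor>x $ i\<rfloor>) \<in> unit_cell"
    by (auto simp: le_floor_iff) linarith
next
  fix k assume "x + int_vec k \<in> unit_cell"
  then have "0 \<le> x $ i + of_int (k $ i)" "x $ i + of_int (k $ i) < 1" for i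
    by auto
  then have "\<lfloor>x $ i\<rfloor> = - (k $ i)" for i
    by (smt (verit, best) floor_unique of_int_minus)
  then show "k = (\<chi> i. - \<lfloor>x $ i\<rfloor>)"
    by (simp add: vec_eq_iff)
qed

text \<open>The sign is reversed for use with reflected cells: adding an integer vector to
  \<open>x\<close> subtracts it from \<open>a - x\<close>.\<close>

lemma unit_cell_neg_translate: "\<exists>!k. x + int_vec (- k) \<in> unit_cell"
proof -
  obtain k where k: "x + int_vec k \<in> unit_cell" "\<And>l. x + int_vec l \<in> unit_cell \<Longrightarrow> l = k"
    using unit_cell_translate[of x] by (elim ex1E) blast
  show ?thesis
  proof (rule ex1I)
    show "x + int_vec (- (- k)) \<in> unit_cell"
      using k(1) by (simp only: minus_minus)
    show "l = - k" if "x + int_vec (- l) \<in> unit_cell" for l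
      using k(2)[OF that] by (metis minus_minus)
  qed
qed

lemma sets_unit_cell [measurable]: "unit_cell \<in> sets borel"
  by measurable

text \<open>The Jacobian is a power of \<open>\<bar>c\<bar> = 1\<close>. The value
  \<open>c = 1\<close> covers translations and \<open>c = -1\<close> reflections.\<close>

lemma emeasure_lborel_affine:
  fixes S :: "'a::euclidean_space set"
  assumes "S \<in> sets borel" "\<bar>c\<bar> = 1"
  shows "emeasure lborel ((\<lambda>x. t + c *\<^sub>R x) -` S) = emeasure lborel S"
proof -
  have "lborel = distr (lborel :: 'a measure) borel (\<lambda>x. t + c *\<^sub>R x)"
    using lborel_affine[of c t] assms(2) by (auto simp: density_1)
  then show ?thesis
    using emeasure_distr[of "\<lambda>x. t + c *\<^sub>R x" lborel borel S] assms(1) by simp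
qed

text \<open>
  Both sets are cut into pieces indexed by \<open>k\<close>: the piece of \<open>D\<close> that is moved into the unit cell by
  \<open>k\<close> and the piece of the unit cell that is moved into \<open>D\<close> by \<open>- k\<close> are translates of each other.
\<close>

lemma emeasure_fundamental_domain:
  fixes B D :: "(real ^ 'n::finite) set"
  assumes D: "D \<in> sets borel" "\<And>x. \<exists>!k. x + int_vec k \<in> D"
    and B: "B \<in> sets borel" "\<And>x k. x + int_vec k \<in> B \<longleftrightarrow> x \<in> B"
  shows "emeasure lborel (D \<inter> B) = emeasure lborel (unit_cell \<inter> B)"
proof -
  let ?T = "\<lambda>k S. {x :: real ^ 'n. x + int_vec k \<in> S}"
  have T [measurable]: "?T k S \<in> sets borel" if "S \<in> sets borel" for S k
    using that by measurable
  have neg: "(x :: real ^ 'n) = (x + int_vec (- k)) + int_vec k" for x k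
    by (simp add: vec_eq_iff)
  have shift: "emeasure lborel (D \<inter> B \<inter> ?T k unit_cell) = emeasure lborel (unit_cell \<inter> B \<inter> ?T (- k) D)" for k
  proof -
    have "unit_cell \<inter> B \<inter> ?T (- k) D = (\<lambda>x. int_vec (- k) + 1 *\<^sub>R x) -` (D \<inter> B \<inter> ?T k unit_cell)"
      using neg[of _ k] B(2)[of _ "- k"] by (auto simp: add.commute)
    then show ?thesis
      using D B by (simp only:) (subst emeasure_lborel_affine, auto)
  qed
  have U: "emeasure lborel (D \<inter> B) = (\<integral>\<^sup>+k. emeasure lborel (D \<inter> B \<inter> ?T k unit_cell) \<partial>count_space UNIV)"
  proof (subst emeasure_UN_countable[symmetric])
    show "disjoint_family_on (\<lambda>k. D \<inter> B \<inter> ?T k unit_cell) UNIV"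
      unfolding disjoint_family_on_def using unit_cell_translate by blast
    have "\<exists>k. x \<in> ?T k unit_cell" for x
      unfolding mem_Collect_eq[of x] using unit_cell_translate[of x] by (rule ex1_implies_ex)
    then have "(\<Union>k. D \<inter> B \<inter> ?T k unit_cell) = D \<inter> B"
      by blast
    then show "emeasure lborel (D \<inter> B) = emeasure lborel (\<Union>k. D \<inter> B \<inter> ?T k unit_cell)"
      by simp
  qed (use D B in auto)
  also have "\<dots> = (\<integral>\<^sup>+k. emeasure lborel (unit_cell \<inter> B \<inter> ?T (- k) D) \<partial>count_space UNIV)"
    by (simp only: shift)
  also have "\<dots> = (\<integral>\<^sup>+k. emeasure lborel (unit_cell \<inter> B \<inter> ?T k D) \<partial>count_space UNIV)"
    by (rule nn_integral_bij_count_space) (auto intro!: bij_uminus)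
  also have "\<dots> = emeasure lborel (unit_cell \<inter> B)"
  proof (subst emeasure_UN_countable[symmetric])
    show "disjoint_family_on (\<lambda>k. unit_cell \<inter> B \<inter> ?T k D) UNIV"
      unfolding disjoint_family_on_def using D(2) by blast
    have "\<exists>k. x \<in> ?T k D" for x
      unfolding mem_Collect_eq[of x] using D(2)[of x] by (rule ex1_implies_ex)
    then have "(\<Union>k. unit_cell \<inter> B \<inter> ?T k D) = unit_cell \<inter> B"
      by blast
    then show "emeasure lborel (\<Union>k. unit_cell \<inter> B \<inter> ?T k D) = emeasure lborel (unit_cell \<inter> B)"
      by simp
  qed (use D B in auto)
  finally show ?thesis .
qed

section \<open>Total mass and invariance of the torus measure\<close>

lemma sets_torus_measure [simp, measurable_cong]: "sets torus_measure = sets borel"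
  and space_torus_measure [simp]: "space torus_measure = UNIV"
  by (simp_all add: torus_measure_def)

lemma emeasure_torus_measure:
  assumes "A \<in> sets borel"
  shows "emeasure torus_measure A = emeasure lborel (unit_cell \<inter> to_torus -` A)"
  unfolding torus_measure_def
  using assms measurable_sets[OF borel_measurable_to_torus assms]
  by (subst emeasure_distr[OF measurable_to_torus])
    (auto simp: space_restrict_space emeasure_restrict_space Int_commute)

lemma inner_Basis_one: "b \<in> Basis \<Longrightarrow> (1 :: real ^ 'n::finite) \<bullet> b = 1"
  by (auto simp: Basis_vec_def inner_axis)

text \<open>The half-open cell is squeezed between the open and the closed unit box, both of volume
  \<open>1\<close>.\<close>

lemma emeasure_torus_measure_UNIV: "emeasure (torus_measure :: 'n::finite torus measure) UNIV = 1"
proof -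
  have "emeasure lborel (unit_cell :: (real ^ 'n) set) = 1"
  proof (rule antisym)
    have c: "emeasure lborel (cbox 0 1 :: (real ^ 'n) set) = 1" "emeasure lborel (box 0 1 :: (real ^ 'n) set) = 1"
      by (simp_all add: emeasure_lborel_cbox_eq emeasure_lborel_box_eq inner_Basis_one)
    have "emeasure lborel (unit_cell :: (real ^ 'n) set) \<le> emeasure lborel (cbox 0 1 :: (real ^ 'n) set)"
      by (intro emeasure_mono) (auto simp: mem_box_cart less_imp_le)
    with c show "emeasure lborel (unit_cell :: (real ^ 'n) set) \<le> 1" by simp
    have "emeasure lborel (box 0 1 :: (real ^ 'n) set) \<le> emeasure lborel (unit_cell :: (real ^ 'n) set)"
      by (intro emeasure_mono) (auto simp: mem_box_cart less_imp_le)
    with c show "1 \<le> emeasure lborel (unit_cell :: (real ^ 'n) set)" by simp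
  qed
  then show ?thesis by (simp add: emeasure_torus_measure)
qed

lemma finite_measure_torus: "finite_measure torus_measure"
  by standard (simp add: emeasure_torus_measure_UNIV)

text \<open>After lifting to Euclidean space, the reflection carries the unit cell to the set
  \<open>?D\<close>, which is again a fundamental domain. A periodic set has the same volume in
  \<open>?D\<close> as in the unit cell.\<close>

lemma distr_torus_measure_diff:
  fixes c :: "'n::finite torus"
  shows "distr torus_measure borel (\<lambda>t. c - t) = torus_measure"
proof (rule measure_eqI)
  obtain a where c: "c = to_torus a" using torus_surj by blast
  have m [measurable]: "(\<lambda>t. c - t) \<in> borel_measurable borel"
    by (intro borel_measurable_continuous_onI continuous_on_torus_diff[where h = "\<lambda>x. x"] continuous_on_id)
  fix A assume "A \<in> sets (distr torus_measure borel (\<lambda>t. c - t))"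
  then have A [measurable]: "A \<in> sets borel" by simp
  let ?D = "{x. a - x \<in> unit_cell}"
  have "emeasure (distr torus_measure borel (\<lambda>t. c - t)) A = emeasure torus_measure ((\<lambda>t. c - t) -` A)"
    by (subst emeasure_distr) auto
  also have "\<dots> = emeasure lborel (unit_cell \<inter> to_torus -` ((\<lambda>t. c - t) -` A))"
    using measurable_sets[OF m A] by (subst emeasure_torus_measure) auto
  also have "unit_cell \<inter> to_torus -` ((\<lambda>t. c - t) -` A) = (\<lambda>x. a + (-1) *\<^sub>R x) -` (?D \<inter> to_torus -` A)"
    by (auto simp: c minus_torus.abs_eq)
  also have "emeasure lborel \<dots> = emeasure lborel (?D \<inter> to_torus -` A)"
    using measurable_sets[OF borel_measurable_to_torus A]
    by (intro emeasure_lborel_affine sets.Int) auto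
  also have "\<dots> = emeasure lborel (unit_cell \<inter> to_torus -` A)"
  proof (rule emeasure_fundamental_domain)
    show "to_torus -` A \<in> sets borel"
      using measurable_sets[OF borel_measurable_to_torus A] by simp
    fix x
    have "a - (x + int_vec k) = a - x + int_vec (- k)" for k
      by (simp add: vec_eq_iff)
    then show "\<exists>!k. x + int_vec k \<in> ?D"
      using unit_cell_neg_translate[of "a - x"] by (simp only: mem_Collect_eq[of _ "\<lambda>x. a - x \<in> unit_cell"])
  qed auto
  also have "\<dots> = emeasure torus_measure A"
    by (simp add: emeasure_torus_measure)
  finally show "emeasure (distr torus_measure borel (\<lambda>t. c - t)) A = emeasure torus_measure A" .
qed simp

lemma integral_torus_reflect:
  fixes f :: "'n::finite torus \<Rightarrow> 'b::{banach, second_countable_topology}"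
  assumes "f \<in> borel_measurable borel"
  shows "(LINT t|torus_measure. f (c - t)) = (LINT t|torus_measure. f t)"
proof -
  have [measurable]: "(\<lambda>t. c - t) \<in> borel_measurable borel"
    by (intro borel_measurable_continuous_onI continuous_on_torus_diff[where h = "\<lambda>x. x"] continuous_on_id)
  have "(LINT t|torus_measure. f t) = (LINT t|distr torus_measure borel (\<lambda>t. c - t). f t)"
    by (simp only: distr_torus_measure_diff)
  also have "\<dots> = (LINT t|torus_measure. f (c - t))"
    using assms by (intro integral_distr) auto
  finally show ?thesis ..
qed

text \<open>A translation is the composition of two reflections.\<close>

lemma integral_torus_translate:
  fixes f :: "'n::finite torus \<Rightarrow> 'b::{banach, second_countable_topology}"
  assumes "f \<in> borel_measurable borel"
  shows "(LINT t|torus_measure. f (t - c)) = (LINT t|torus_measure. f t)"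
proof -
  have [measurable]: "(\<lambda>t. - c - t) \<in> borel_measurable borel"
    by (intro borel_measurable_continuous_onI continuous_on_torus_diff[where h = "\<lambda>x. x"] continuous_on_id)
  have "(\<lambda>t. f (- c - t)) \<in> borel_measurable borel"
    using assms by measurable
  from integral_torus_reflect[OF this, of 0] show ?thesis
    using integral_torus_reflect[OF assms, of "- c"] by simp
qed

subsection \<open>Signed measures and their integrals\<close>

text \<open>A linear relation between finite measures passes from sets to bounded functions by the
  usual induction over indicators, sums and monotone limits. The list form lets relations with any
  number of measures, such as those between Jordan parts, be handled at once.\<close>

lemma integral_combination_eq_0:
  fixes L :: "(real \<times> 'a measure) list" and f :: "'a \<Rightarrow> real"
  assumes L: "\<And>c M. (c, M) \<in> set L \<Longrightarrow> finite_measure M \<and> sets M = sets N"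
    and zero: "\<And>A. A \<in> sets N \<Longrightarrow> (\<Sum>(c, M)\<leftarrow>L. c * measure M A) = 0"
    and f: "f \<in> borel_measurable N" "\<And>x. \<bar>f x\<bar> \<le> B"
  shows "(\<Sum>(c, M)\<leftarrow>L. c * (LINT x|M. f x)) = 0"
proof -
  let ?I = "\<lambda>u. \<Sum>(c, M)\<leftarrow>L. c * (LINT x|M. u x)"
  have sp: "space M = space N" if "(c, M) \<in> set L" for c M
    using L[OF that] sets_eq_imp_space_eq by blast
  have meas: "u \<in> borel_measurable M" if "(c, M) \<in> set L" "u \<in> borel_measurable N" for c M and u :: "'a \<Rightarrow> real"
    using L[OF that(1)] that(2) measurable_cong_sets by blast
  have int: "integrable M u" if "(c, M) \<in> set L" "u \<in> borel_measurable N" "\<And>x. x \<in> space N \<Longrightarrow> \<bar>u x\<bar> \<le> B"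
    for c M B and u :: "'a \<Rightarrow> real"
    using L[OF that(1)] that(3) sp[OF that(1)]
    by (intro finite_measure.integrable_const_bound[of M u B] AE_I2 meas[OF that(1,2)]) auto
  \<comment> \<open>The bound keeps all integrals finite. It stays inside the induction and varies,
    because a bound \<open>B\<close> for \<open>c * u\<close> becomes \<open>B / c\<close> for
    \<open>u\<close>.\<close>
  have nonneg: "(\<forall>x\<in>space N. u x \<le> B) \<longrightarrow> ?I u = 0"
    if u_meas: "u \<in> borel_measurable N" and u_nonneg: "\<And>x. 0 \<le> u x" for u B
    using u_meas u_nonneg
  proof (induction arbitrary: B rule: borel_measurable_induct_real)
    case (set A)
    have "?I (indicator A) = (\<Sum>(c, M)\<leftarrow>L. c * measure M A)"
      using set sets.sets_into_space[OF set] sp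
      by (intro arg_cong[where f = sum_list] map_cong) (auto simp: Int_absorb2)
    then show ?case using zero[OF set] by simp
  next
    case (mult u c)
    show ?case
    proof
      assume le: "\<forall>x\<in>space N. c * u x \<le> B"
      have "?I (\<lambda>x. c * u x) = c * ?I u"
        by (simp add: sum_list_const_mult[symmetric] case_prod_unfold mult.left_commute)
      moreover have "c = 0 \<or> ?I u = 0"
      proof (cases "c = 0")
        case False
        then have "\<forall>x\<in>space N. u x \<le> B / c" using le mult.hyps(1) by (simp add: field_simps)
        then show ?thesis using mult.IH by blast
      qed simp
      ultimately show "?I (\<lambda>x. c * u x) = 0" by auto
    qed
  next
    case (add u v)
    show ?case
    proof
      assume le: "\<forall>x\<in>space N. v x + u x \<le> B"
      have b: "v x \<le> B" "u x \<le> B" "\<bar>v x\<bar> \<le> B" "\<bar>u x\<bar> \<le> B" if "x \<in> space N" for x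
        using le[rule_format, OF that] add.hyps(2)[of x] add.hyps(4)[of x] by linarith+
      have "?I (\<lambda>x. v x + u x) = (\<Sum>(c, M)\<leftarrow>L. c * (LINT x|M. v x) + c * (LINT x|M. u x))"
        using int[OF _ add.hyps(1) b(4)] int[OF _ add.hyps(3) b(3)]
        by (intro arg_cong[where f = sum_list] map_cong) (auto simp: algebra_simps)
      also have "\<dots> = ?I v + ?I u"
        by (simp add: sum_list_addf case_prod_unfold)
      also have "\<dots> = 0" using add.IH[of B] b(1,2) by simp
      finally show "?I (\<lambda>x. v x + u x) = 0" .
    qed
  next
    case (seq U)
    show ?case
    proof
      assume le: "\<forall>x\<in>space N. u x \<le> B"
      have Ule: "U i x \<le> B" if "x \<in> space N" for i x
        using incseq_le[OF _ seq.hyps(4)[OF that], of i] seq.hyps(3) le that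
        by (fastforce simp: incseq_def le_fun_def)
      have "(\<lambda>i. ?I (U i)) \<longlonglongrightarrow> ?I u"
        unfolding sum_list_sum_nth length_map
      proof (intro tendsto_sum)
        fix j assume j: "j \<in> {0..<length L}"
        obtain c M where cM: "L ! j = (c, M)" by fastforce
        then have M: "(c, M) \<in> set L" using j by (metis atLeastLessThan_iff nth_mem)
        interpret finite_measure M using L[OF M] by simp
        have "(\<lambda>i. LINT x|M. U i x) \<longlonglongrightarrow> (LINT x|M. u x)"
        proof (rule integral_dominated_convergence[where w = "\<lambda>_. B"])
          show "AE x in M. (\<lambda>i. U i x) \<longlonglongrightarrow> u x" using seq.hyps(4) sp[OF M] by (intro AE_I2) auto
          show "AE x in M. norm (U i x) \<le> B" for i using Ule seq.hyps(2) sp[OF M] by (intro AE_I2) auto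
        qed (simp_all add: meas[OF M] seq.hyps(1) u_meas)
        then show "(\<lambda>i. map (\<lambda>(c, M). c * (LINT x|M. U i x)) L ! j) \<longlonglongrightarrow> map (\<lambda>(c, M). c * (LINT x|M. u x)) L ! j"
          using j by (simp add: cM tendsto_mult_left)
      qed
      moreover have "?I (U i) = 0" for i
        using seq.IH Ule by blast
      ultimately show "?I u = 0"
        using LIMSEQ_unique[OF _ tendsto_const] by simp
    qed
  qed
  \<comment> \<open>A function of arbitrary sign is the difference of \<open>p f\<close> and
    \<open>p (\<lambda>x. - f x)\<close>, and both are nonnegative and bounded by
    \<open>B\<close>.\<close>
  define p where "p u x = max 0 (u x)" for u :: "'a \<Rightarrow> real" and x
  have p: "p u \<in> borel_measurable N" "0 \<le> p u x" if "u \<in> borel_measurable N" for u x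
    using that by (auto simp: p_def[abs_def])
  have bnd: "p f x \<le> B" "p (\<lambda>x. - f x) x \<le> B" for x
    using f(2)[of x] by (auto simp: p_def)
  have "?I f = (\<Sum>(c, M)\<leftarrow>L. c * (LINT x|M. p f x) - c * (LINT x|M. p (\<lambda>x. - f x) x))"
  proof (intro arg_cong[where f = sum_list] map_cong refl, safe)
    fix c M assume M: "(c, M) \<in> set L"
    have "(LINT x|M. f x) = (LINT x|M. p f x - p (\<lambda>x. - f x) x)"
      by (intro Bochner_Integration.integral_cong) (auto simp: p_def)
    also have "\<dots> = (LINT x|M. p f x) - (LINT x|M. p (\<lambda>x. - f x) x)"
      using bnd p f(1) by (intro Bochner_Integration.integral_diff int[OF M, where B = B]) auto
    finally show "c * (LINT x|M. f x) = c * (LINT x|M. p f x) - c * (LINT x|M. p (\<lambda>x. - f x) x)"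
      by (simp add: right_diff_distrib)
  qed
  also have "\<dots> = ?I (p f) - ?I (p (\<lambda>x. - f x))"
    by (simp add: sum_list_subtractf case_prod_unfold)
  also have "\<dots> = 0"
    using nonneg[OF p, of f B] nonneg[OF p, of "\<lambda>x. - f x" B] f(1) bnd by simp
  finally show ?thesis .
qed

section \<open>Jordan decomposition and linearity of the integral in the measure\<close>

lemma sm_value_finite: "total_variation (sm_value \<mu>) < \<infinity>"
  and is_signed_measure_sm_value: "is_signed_measure (sm_value \<mu>)"
  and sm_value_not_borel: "A \<notin> sets borel \<Longrightarrow> sm_value \<mu> A = 0"
  using sm_value[of \<mu>] unfolding mem_Collect_eq by blast+

lemma sm_value_uminus: "sm_value (- \<mu>) A = - sm_value \<mu> A"
  unfolding uminus_signed_measure_def scaleR_signed_measure.rep_eq by simp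

lemma sm_value_Un:
  assumes "A \<in> sets borel" "B \<in> sets borel" "A \<inter> B = {}"
  shows "sm_value \<mu> (A \<union> B) = sm_value \<mu> A + sm_value \<mu> B"
proof -
  have "sm_value \<mu> {} = 0"
    using is_signed_measure_sm_value[of \<mu>] by (simp add: is_signed_measure_def)
  moreover have "range (binaryset A B) \<subseteq> sets borel" "disjoint_family (binaryset A B)"
    using assms by (auto simp: range_binaryset_eq disjoint_family_on_def binaryset_def)
  then have "(\<lambda>i. sm_value \<mu> (binaryset A B i)) sums sm_value \<mu> (\<Union>i. binaryset A B i)"
    using is_signed_measure_sm_value[of \<mu>] by (simp add: is_signed_measure_def)
  ultimately show ?thesis
    using binaryset_sums[of "sm_value \<mu>" A B] unfolding UN_binaryset_eq by (blast intro: sums_unique2)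
qed

text \<open>The one-element family \<open>{B}\<close> is admissible in the total variation, which
  therefore bounds every value \<open>sm_value \<mu> B\<close>.\<close>

lemma finite_measure_pos_part: "finite_measure (pos_part (\<mu> :: 'a::topological_space signed_measure))"
proof
  have "emeasure (pos_part \<mu>) UNIV \<le> total_variation (sm_value \<mu>)"
    unfolding emeasure_pos_part[OF borel_open[OF open_UNIV]]
  proof (rule SUP_least)
    fix B assume B: "B \<in> {B \<in> sets borel. B \<subseteq> (UNIV :: 'a set)}"
    have "ennreal (sm_value \<mu> B) \<le> (\<Sum>A\<in>{B}. ennreal \<bar>sm_value \<mu> A\<bar>)"
      by (simp add: ennreal_leI)
    also have "\<dots> \<le> total_variation (sm_value \<mu>)"
      unfolding total_variation_def using B by (intro SUP_upper) auto
    finally show "ennreal (sm_value \<mu> B) \<le> total_variation (sm_value \<mu>)" .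
  qed
  then show "emeasure (pos_part \<mu>) (space (pos_part \<mu>)) \<noteq> \<infinity>"
    using sm_value_finite[of \<mu>] by (auto simp: top_unique)
qed

lemma sets_neg_part [simp, measurable_cong]: "sets (neg_part (\<mu> :: 'a::topological_space signed_measure)) = sets borel"
  and space_neg_part [simp]: "space (neg_part \<mu>) = UNIV"
  and finite_measure_neg_part: "finite_measure (neg_part \<mu>)"
  by (simp_all add: neg_part_def finite_measure_pos_part)

text \<open>For Borel \<open>B \<subseteq> A\<close>, additivity gives
  \<open>\<mu> B = \<mu> A + (- \<mu>) (A - B)\<close>, and the last term is at most the negative
  part of \<open>A\<close>. The supremum over \<open>B\<close> yields one inequality; the same
  argument for \<open>- \<mu>\<close> yields the other.\<close>

lemma jordan_decomposition:
  assumes A: "A \<in> sets borel"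
  shows "sm_value \<mu> A = measure (pos_part \<mu>) A - measure (neg_part \<mu>) A"
proof -
  have le: "measure (pos_part \<nu>) A \<le> sm_value \<nu> A + measure (pos_part (- \<nu>)) A" for \<nu> :: "'a signed_measure"
  proof -
    interpret P: finite_measure "pos_part \<nu>" by (rule finite_measure_pos_part)
    interpret N: finite_measure "pos_part (- \<nu>)" by (rule finite_measure_pos_part)
    have ub: "sm_value \<nu> B \<le> sm_value \<nu> A + measure (pos_part (- \<nu>)) A"
      if B: "B \<in> sets borel" "B \<subseteq> A" for B
    proof -
      have "ennreal (sm_value (- \<nu>) (A - B)) \<le> emeasure (pos_part (- \<nu>)) A"
        unfolding emeasure_pos_part[OF A] using A B by (intro SUP_upper) auto
      then have "sm_value (- \<nu>) (A - B) \<le> measure (pos_part (- \<nu>)) A"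
        by (simp add: N.emeasure_eq_measure)
      moreover have "sm_value \<nu> A = sm_value \<nu> B + sm_value \<nu> (A - B)"
        using sm_value_Un[of B "A - B" \<nu>] A B by (simp add: Un_absorb1)
      ultimately show ?thesis by (simp add: sm_value_uminus)
    qed
    \<comment> \<open>Nonnegativity, from \<open>B = {}\<close>, allows the passage back from
      \<open>ennreal\<close> to the reals.\<close>
    have "0 \<le> sm_value \<nu> A + measure (pos_part (- \<nu>)) A"
      using ub[of "{}"] is_signed_measure_sm_value[of \<nu>] by (simp add: is_signed_measure_def)
    moreover have "emeasure (pos_part \<nu>) A \<le> ennreal (sm_value \<nu> A + measure (pos_part (- \<nu>)) A)"
      unfolding emeasure_pos_part[OF A] using ub by (intro SUP_least) (auto intro!: ennreal_leI)
    ultimately show ?thesis by (simp add: P.emeasure_eq_measure)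
  qed
  have "- (- \<mu>) = \<mu>" by simp
  with le[of \<mu>] le[of "- \<mu>"] show ?thesis
    by (simp add: neg_part_def sm_value_uminus)
qed

text \<open>Jordan parts are not additive, because of cancellation. The six measures nevertheless
  satisfy a linear relation on Borel sets, and this relation carries over to integrals.\<close>

lemma signed_integral_add:
  assumes f: "f \<in> borel_measurable borel" "\<And>x. \<bar>f x\<bar> \<le> B"
  shows "signed_integral (\<mu> + \<nu>) f = signed_integral \<mu> f + signed_integral \<nu> f"
proof -
  let ?L = "[(1, pos_part (\<mu> + \<nu>)), (-1, neg_part (\<mu> + \<nu>)), (-1, pos_part \<mu>), (1, neg_part \<mu>),
      (-1, pos_part \<nu>), (1, neg_part \<nu>)]"
  have "(\<Sum>(c, M)\<leftarrow>?L. c * (LINT x|M. f x)) = 0"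
  proof (rule integral_combination_eq_0[OF _ _ f])
    show "finite_measure M \<and> sets M = sets borel" if "(c, M) \<in> set ?L" for c M
      using that by (auto simp: finite_measure_pos_part finite_measure_neg_part)
    show "(\<Sum>(c, M)\<leftarrow>?L. c * measure M A) = 0" if "A \<in> sets borel" for A
      using jordan_decomposition[OF that, of \<mu>] jordan_decomposition[OF that, of \<nu>]
        jordan_decomposition[OF that, of "\<mu> + \<nu>"]
      by (simp add: plus_signed_measure.rep_eq)
  qed
  then show ?thesis by (simp add: signed_integral_def)
qed

lemma signed_integral_scaleR:
  assumes f: "f \<in> borel_measurable borel" "\<And>x. \<bar>f x\<bar> \<le> B"
  shows "signed_integral (c *\<^sub>R \<mu>) f = c * signed_integral \<mu> f"
proof -
  \<comment> \<open>This single relation covers both signs of \<open>c\<close>, although a negative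
    \<open>c\<close> exchanges the roles of the Jordan parts.\<close>
  let ?L = "[(1, pos_part (c *\<^sub>R \<mu>)), (-1, neg_part (c *\<^sub>R \<mu>)), (- c, pos_part \<mu>), (c, neg_part \<mu>)]"
  have "(\<Sum>(c, M)\<leftarrow>?L. c * (LINT x|M. f x)) = 0"
  proof (rule integral_combination_eq_0[OF _ _ f])
    show "finite_measure M \<and> sets M = sets borel" if "(d, M) \<in> set ?L" for d M
      using that by (auto simp: finite_measure_pos_part finite_measure_neg_part)
    show "(\<Sum>(c, M)\<leftarrow>?L. c * measure M A) = 0" if "A \<in> sets borel" for A
      using arg_cong[OF jordan_decomposition[OF that, of \<mu>], of "(*) c"]
        jordan_decomposition[OF that, of "c *\<^sub>R \<mu>"]
      by (simp add: scaleR_signed_measure.rep_eq right_diff_distrib)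
  qed
  then show ?thesis by (simp add: signed_integral_def algebra_simps)
qed

section \<open>Signed measures built from positive measures and from densities\<close>

lemma signed_measure_of_difference:
  fixes P N :: "'a::topological_space measure"
  assumes fin: "finite_measure P" "finite_measure N" and sets: "sets P = sets borel" "sets N = sets borel"
  shows "sm_value (Abs_signed_measure (\<lambda>A. measure P A - measure N A)) = (\<lambda>A. measure P A - measure N A)"
proof (rule Abs_signed_measure_inverse, safe)
  interpret P: finite_measure P by fact
  interpret N: finite_measure N by fact
  show "is_signed_measure (\<lambda>A. measure P A - measure N A)"
    unfolding is_signed_measure_def
    using P.finite_measure_UNION N.finite_measure_UNION sets by (auto intro!: sums_diff)
  have "total_variation (\<lambda>A. measure P A - measure N A) \<le> ennreal (measure P (space P) + measure N (space N))"
    unfolding total_variation_def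
  proof (rule SUP_least)
    fix F :: "'a set set" assume "F \<in> {P. finite P \<and> P \<subseteq> sets borel \<and> disjoint P}"
    then have F: "finite F" "F \<subseteq> sets borel" "disjoint_family_on (\<lambda>A. A) F"
      by (auto simp: disjoint_family_on_disjoint_image disjoint_def disjoint_family_on_def)
    have "(\<Sum>A\<in>F. \<bar>measure P A - measure N A\<bar>) \<le> (\<Sum>A\<in>F. measure P A + measure N A)"
      by (intro sum_mono) (smt (verit) measure_nonneg)
    also have "\<dots> = measure P (\<Union>A\<in>F. A) + measure N (\<Union>A\<in>F. A)"
      using F sets
        P.finite_measure_finite_Union[of F "\<lambda>A. A"] N.finite_measure_finite_Union[of F "\<lambda>A. A"]
      by (simp add: sum.distrib)
    also have "\<dots> \<le> measure P (space P) + measure N (space N)"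
      by (intro add_mono P.bounded_measure N.bounded_measure)
    finally show "(\<Sum>A\<in>F. ennreal \<bar>measure P A - measure N A\<bar>) \<le> ennreal (measure P (space P) + measure N (space N))"
      by (simp add: sum_ennreal ennreal_leI del: ennreal_plus)
  qed
  then show "total_variation (\<lambda>A. measure P A - measure N A) < \<infinity>"
    by (rule le_less_trans) simp
  show "measure P A - measure N A = 0" if "A \<notin> sets borel" for A
    using that sets by (simp add: measure_notin_sets)
qed

text \<open>\<open>P\<close> and \<open>N\<close> may overlap and so differ from the Jordan parts,
  but both pairs have the same difference on Borel sets.\<close>

lemma signed_integral_of_difference:
  fixes P N :: "'a::topological_space measure"
  assumes fin: "finite_measure P" "finite_measure N" and sets: "sets P = sets borel" "sets N = sets borel"
    and f: "f \<in> borel_measurable borel" "\<And>x. \<bar>f x\<bar> \<le> B"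
  shows "signed_integral (Abs_signed_measure (\<lambda>A. measure P A - measure N A)) f = (LINT x|P. f x) - (LINT x|N. f x)"
proof -
  define \<mu> where "\<mu> = Abs_signed_measure (\<lambda>A. measure P A - measure N A)"
  have \<mu>: "sm_value \<mu> A = measure P A - measure N A" for A
    by (simp add: \<mu>_def signed_measure_of_difference[OF fin sets])
  let ?L = "[(1, pos_part \<mu>), (-1, neg_part \<mu>), (-1, P), (1, N)]"
  have "(\<Sum>(c, M)\<leftarrow>?L. c * (LINT x|M. f x)) = 0"
  proof (rule integral_combination_eq_0[OF _ _ f])
    show "finite_measure M \<and> sets M = sets borel" if "(c, M) \<in> set ?L" for c M
      using that by (auto simp: fin sets finite_measure_pos_part finite_measure_neg_part)
    show "(\<Sum>(c, M)\<leftarrow>?L. c * measure M A) = 0" if "A \<in> sets borel" for A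
      using jordan_decomposition[OF that, of \<mu>] by (simp add: \<mu>)
  qed
  then have "signed_integral \<mu> f = (LINT x|P. f x) - (LINT x|N. f x)"
    by (simp add: signed_integral_def)
  then show ?thesis by (simp only: \<mu>_def)
qed

text \<open>The measure is the difference of the measures with densities \<open>max 0 (g x)\<close>
  and \<open>max 0 (- g x)\<close>; these are finite because \<open>g\<close> is bounded and
  \<open>M\<close> is finite.\<close>

lemma signed_measure_of_density:
  fixes M :: "'a::topological_space measure" and g :: "'a \<Rightarrow> real"
  assumes M: "finite_measure M" "sets M = sets borel"
    and g: "g \<in> borel_measurable borel" "\<And>x. \<bar>g x\<bar> \<le> C"
  shows "\<exists>\<mu>. \<forall>f B. f \<in> borel_measurable borel \<longrightarrow> (\<forall>x. \<bar>f x\<bar> \<le> B) \<longrightarrow>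
    signed_integral \<mu> f = (LINT x|M. g x * f x)"
proof -
  interpret finite_measure M by fact
  note [measurable_cong] = M(2)
  note g(1) [measurable]
  let ?D = "\<lambda>g. density M (\<lambda>x. ennreal (max 0 (g x)))"
  have fin: "finite_measure (?D g)" if [measurable]: "g \<in> borel_measurable borel" and "\<And>x. \<bar>g x\<bar> \<le> C" for g
  proof
    have "emeasure (?D g) (space (?D g)) = (\<integral>\<^sup>+x. ennreal (max 0 (g x)) \<partial>M)"
      by (subst emeasure_density) (auto intro!: nn_integral_cong)
    also have "\<dots> \<le> (\<integral>\<^sup>+x. ennreal C \<partial>M)"
      using that(2) by (intro nn_integral_mono ennreal_leI) (smt (verit))
    also have "\<dots> < \<infinity>"
      by (simp add: ennreal_mult_eq_top_iff less_top[symmetric])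
    finally show "emeasure (?D g) (space (?D g)) \<noteq> \<infinity>" by simp
  qed
  define \<mu> where "\<mu> = Abs_signed_measure (\<lambda>A. measure (?D g) A - measure (?D (\<lambda>x. - g x)) A)"
  have "signed_integral \<mu> f = (LINT x|M. g x * f x)"
    if f [measurable]: "f \<in> borel_measurable borel" and B: "\<And>x. \<bar>f x\<bar> \<le> B" for f B
  proof -
    have int: "integrable M (\<lambda>x. max 0 (u x) * f x)"
      if [measurable]: "u \<in> borel_measurable borel" and "\<And>x. \<bar>u x\<bar> \<le> C" for u
    proof (rule integrable_const_bound[where B = "C * B"])
      show "AE x in M. norm (max 0 (u x) * f x) \<le> C * B"
      proof (rule AE_I2)
        fix x
        have "0 \<le> C" "\<bar>max 0 (u x)\<bar> \<le> C" using that(2)[of x] by auto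
        then show "norm (max 0 (u x) * f x) \<le> C * B"
          using B[of x] by (simp only: real_norm_def abs_mult) (intro mult_mono, auto)
      qed
    qed measurable
    have "signed_integral \<mu> f = (LINT x|?D g. f x) - (LINT x|?D (\<lambda>x. - g x). f x)"
      unfolding \<mu>_def using fin g B M(2)
      by (intro signed_integral_of_difference[where B = B]) auto
    also have "\<dots> = (LINT x|M. max 0 (g x) * f x) - (LINT x|M. max 0 (- g x) * f x)"
      by (simp add: integral_density)
    also have "\<dots> = (LINT x|M. max 0 (g x) * f x - max 0 (- g x) * f x)"
      using g int by (intro Bochner_Integration.integral_diff[symmetric]) auto
    also have "\<dots> = (LINT x|M. g x * f x)"
      by (intro Bochner_Integration.integral_cong) (auto simp: max_def)
    finally show ?thesis .
  qed
  then show ?thesis by blast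
qed

subsection \<open>Characters\<close>

lemma torus_char_to_torus:
  "torus_char \<xi> (to_torus x) = cis (- 2 * pi * (\<Sum>i\<in>UNIV. of_int (\<xi> $ i) * x $ i))"
  by (simp add: torus_char.abs_eq cis_conv_exp algebra_simps)

lemma norm_torus_char [simp]: "norm (torus_char \<xi> x) = 1"
proof -
  obtain a where "x = to_torus a" using torus_surj by blast
  then show ?thesis by (simp add: torus_char_to_torus)
qed

lemma torus_char_add_arg: "torus_char \<xi> (x + y) = torus_char \<xi> x * torus_char \<xi> y"
proof -
  obtain a b where "x = to_torus a" "y = to_torus b" using torus_surj by blast
  then show ?thesis
    by (simp add: torus_char_to_torus plus_torus.abs_eq cis_mult distrib_left sum.distrib)
qed

lemma torus_char_add: "torus_char (\<xi> + \<eta>) x = torus_char \<xi> x * torus_char \<eta> x"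
proof -
  obtain a where "x = to_torus a" using torus_surj by blast
  then show ?thesis
    by (simp add: torus_char_to_torus cis_mult distrib_left distrib_right sum.distrib)
qed

lemma torus_char_0 [simp]: "torus_char 0 x = 1"
proof -
  obtain a where "x = to_torus a" using torus_surj by blast
  then show ?thesis by (simp add: torus_char_to_torus)
qed

lemma torus_char_mult_cnj [simp]: "torus_char \<xi> x * cnj (torus_char \<xi> x) = 1"
  by (simp add: complex_norm_square[symmetric])

lemma torus_char_uminus: "torus_char (- \<xi>) x = cnj (torus_char \<xi> x)"
proof -
  have "torus_char (- \<xi>) x = torus_char (- \<xi>) x * (torus_char \<xi> x * cnj (torus_char \<xi> x))"
    by simp
  also have "\<dots> = torus_char (- \<xi> + \<xi>) x * cnj (torus_char \<xi> x)"
    by (simp only: torus_char_add mult.assoc)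
  finally show ?thesis by simp
qed

lemma torus_char_diff_arg: "torus_char \<xi> (x - y) = torus_char \<xi> x * cnj (torus_char \<xi> y)"
proof -
  have "torus_char \<xi> x = torus_char \<xi> (x - y) * torus_char \<xi> y"
    by (simp flip: torus_char_add_arg)
  then show ?thesis by (simp add: mult.assoc)
qed

lemma continuous_on_torus_char: "continuous_on A (torus_char \<xi>)"
proof (rule continuous_on_subset)
  show "continuous_on UNIV (torus_char \<xi>)"
    unfolding continuous_on_torus_iff o_def torus_char_to_torus
    by (intro continuous_intros continuous_on_cis)
qed simp

lemma borel_measurable_torus_char [measurable]: "torus_char \<xi> \<in> borel_measurable borel"
  by (intro borel_measurable_continuous_onI continuous_on_torus_char)

text \<open>The character of a coordinate axis determines that coordinate modulo
  \<open>\<int>\<close>. This separation of points underlies the Hausdorff property, the use of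
  Stone-Weierstrass and the embedding into \<open>complex ^ 'n\<close>.\<close>

lemma torus_char_axis_eqD:
  assumes "\<And>i. torus_char (axis i 1) x = torus_char (axis i 1) y"
  shows "x = y"
proof -
  obtain a b where ab: "x = to_torus a" "y = to_torus b" using torus_surj by blast
  have ax: "(\<Sum>j\<in>UNIV. of_int (axis i 1 $ j) * c $ j) = c $ i" for i and c :: "real ^ 'a"
    by (simp add: axis_def if_distrib[of of_int] if_distrib[of "\<lambda>r. r * _"] cong: if_cong)
  have "a $ i - b $ i \<in> \<int>" for i
  proof -
    have "cis (- 2 * pi * a $ i) = cis (- 2 * pi * b $ i)"
      using assms[of i] by (simp only: ab torus_char_to_torus ax)
    then obtain n :: int where "\<i> * complex_of_real (- 2 * pi * a $ i) =
        \<i> * complex_of_real (- 2 * pi * b $ i) + complex_of_real (real_of_int (2 * n) * pi) * \<i>"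
      unfolding cis_conv_exp exp_eq by blast
    then have "Im (\<i> * complex_of_real (- 2 * pi * a $ i)) =
        Im (\<i> * complex_of_real (- 2 * pi * b $ i) + complex_of_real (real_of_int (2 * n) * pi) * \<i>)"
      by (rule arg_cong)
    then have "pi * (a $ i - b $ i + of_int n) = 0"
      by (simp add: algebra_simps)
    then have "a $ i - b $ i = of_int (- n)" by simp
    then show ?thesis by (simp only: Ints_of_int)
  qed
  then show ?thesis by (simp add: ab to_torus_eq_iff)
qed

text \<open>Preimages of disjoint complex neighbourhoods under a separating character are disjoint
  open sets. Stone-Weierstrass is formulated for this class.\<close>

instance torus :: (finite) t2_space
proof
  fix x y :: "'a torus" assume "x \<noteq> y"
  then obtain i where "torus_char (axis i 1) x \<noteq> torus_char (axis i 1) y"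
    using torus_char_axis_eqD by blast
  from hausdorff[OF this] obtain U V where UV: "open U" "open V" "torus_char (axis i 1) x \<in> U" "torus_char (axis i 1) y \<in> V" "U \<inter> V = {}"
    by blast
  then have "open (torus_char (axis i 1) -` U)" "open (torus_char (axis i 1) -` V)"
    by (simp_all add: open_vimage continuous_on_torus_char)
  then show "\<exists>U V. open U \<and> open V \<and> x \<in> U \<and> y \<in> V \<and> U \<inter> V = {}"
    using UV by (intro exI[of _ "torus_char (axis i 1) -` U"] exI[of _ "torus_char (axis i 1) -` V"]) auto
qed

text \<open>The section takes values in the closed unit box, so the torus is a continuous image of a
  compact set.\<close>

lemma compact_torus: "compact (UNIV :: 'n::finite torus set)"
proof -
  have "\<exists>x\<in>cbox 0 1. t = to_torus x" for t :: "'n torus"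
  proof
    show "t = to_torus (torus_section t)" by simp
    show "torus_section t \<in> cbox 0 1"
      by (simp add: mem_box_cart torus_section_def less_imp_le[OF frac_lt_1])
  qed
  then have "(UNIV :: 'n torus set) = to_torus ` cbox 0 1" by auto
  then show ?thesis
    using compact_continuous_image[OF continuous_on_to_torus compact_cbox] by metis
qed

lemma bounded_continuous_torus:
  fixes f :: "'n::finite torus \<Rightarrow> 'b::real_normed_vector"
  assumes "continuous_on UNIV f"
  shows "\<exists>B. \<forall>x. norm (f x) \<le> B"
  using compact_imp_bounded[OF compact_continuous_image[OF assms compact_torus]]
  by (auto simp: bounded_iff)

subsection \<open>Measures are determined by their Fourier coefficients\<close>

text \<open>These are the real trigonometric polynomials: the complex factor \<open>c\<close>
  supplies cosine, sine and real scalars in one rule.\<close>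

inductive trig_poly :: "('n::finite torus \<Rightarrow> real) \<Rightarrow> bool" where
  char: "trig_poly (\<lambda>x. Re (c * torus_char \<xi> x))"
| add: "trig_poly f \<Longrightarrow> trig_poly g \<Longrightarrow> trig_poly (\<lambda>x. f x + g x)"

lemma continuous_on_trig_poly: "trig_poly f \<Longrightarrow> continuous_on A f"
  by (induction rule: trig_poly.induct) (auto intro!: continuous_intros continuous_on_torus_char)

lemma trig_poly_mult:
  assumes "trig_poly f" "trig_poly g"
  shows "trig_poly (\<lambda>x. f x * g x)"
  using assms
proof (induction arbitrary: g rule: trig_poly.induct)
  case (char c \<xi>)
  then show ?case
  proof (induction rule: trig_poly.induct)
    case (char d \<eta>)
    \<comment> \<open>This is the product-to-sum formula; the two terms have the frequencies
      \<open>\<xi> + \<eta>\<close> and \<open>\<xi> - \<eta>\<close>.\<close>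
    have *: "Re u * Re v = Re (u * v / 2) + Re (u * cnj v / 2)" for u v
      by (simp add: field_simps)
    have "(\<lambda>x. Re (c * torus_char \<xi> x) * Re (d * torus_char \<eta> x)) =
        (\<lambda>x. Re (c * d / 2 * torus_char (\<xi> + \<eta>) x) + Re (c * cnj d / 2 * torus_char (\<xi> + - \<eta>) x))"
      unfolding * torus_char_add torus_char_uminus by (simp add: mult_ac)
    then show ?case by (simp only: trig_poly.intros)
  next
    case (add f g)
    from trig_poly.add[OF add.IH] show ?case by (simp add: distrib_left)
  qed
next
  case (add f1 f2)
  from trig_poly.add[OF add.IH[OF add.prems]] show ?case by (simp add: distrib_right)
qed

lemma trig_poly_dense:
  fixes f :: "'n::finite torus \<Rightarrow> real"
  assumes "continuous_on UNIV f" "0 < e"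
  obtains g where "trig_poly g" "\<And>x. \<bar>f x - g x\<bar> < e"
proof -
  interpret function_ring_on "Collect (trig_poly :: ('n torus \<Rightarrow> real) \<Rightarrow> bool)" UNIV
  proof
    show "(\<lambda>_. c) \<in> Collect (trig_poly :: ('n torus \<Rightarrow> real) \<Rightarrow> bool)" for c
      using trig_poly.char[of "complex_of_real c" 0] by simp
    fix x y :: "'n torus" assume "x \<noteq> y"
    then obtain i where i: "torus_char (axis i 1) x \<noteq> torus_char (axis i 1) y"
      using torus_char_axis_eqD by blast
    show "\<exists>f\<in>Collect trig_poly. f x \<noteq> f y"
    \<comment> \<open>If the real parts agree, the imaginary parts differ, and the factor
      \<open>- \<i>\<close> turns the imaginary part into a real part.\<close>
    proof (cases "Re (torus_char (axis i 1) x) = Re (torus_char (axis i 1) y)")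
      case True
      then show ?thesis
        using i trig_poly.char[of "- \<i>" "axis i 1"] by (intro bexI) (auto simp: complex_eq_iff)
    next
      case False
      then show ?thesis
        using trig_poly.char[of 1 "axis i 1"] by (intro bexI) auto
    qed
  qed (auto intro: compact_torus trig_poly.add trig_poly_mult continuous_on_trig_poly)
  from Stone_Weierstrass_basic[OF assms] that show ?thesis by auto
qed

text \<open>The coordinate characters embed the torus into the metric space
  \<open>complex ^ 'n\<close>; there \<open>d\<close> is the distance to the image of the complement
  of \<open>U\<close>, which is compact and hence closed.\<close>

lemma torus_open_continuous_approx:
  fixes U :: "'n::finite torus set"
  assumes "open U"
  obtains d :: "'n torus \<Rightarrow> real" where "continuous_on UNIV d" "\<And>x. 0 \<le> d x" "\<And>x. d x = 0 \<longleftrightarrow> x \<notin> U"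
\<comment> \<open>This case is separate because \<open>infdist\<close> to the empty set is
  \<open>0\<close> by convention.\<close>
proof (cases "U = UNIV")
  case True
  then show ?thesis using that[of "\<lambda>_. 1"] by simp
next
  case False
  define \<phi> :: "'n torus \<Rightarrow> complex ^ 'n" where "\<phi> t = (\<chi> i. torus_char (axis i 1) t)" for t
  have \<phi>: "continuous_on A \<phi>" for A
    unfolding \<phi>_def by (intro continuous_intros continuous_on_torus_char)
  have "compact (- U)"
    using compact_Int_closed[OF compact_torus, of "- U"] assms by (simp add: closed_Compl)
  then have c: "compact (\<phi> ` (- U))"
    by (rule compact_continuous_image[OF \<phi>])
  have "infdist (\<phi> x) (\<phi> ` (- U)) = 0 \<longleftrightarrow> \<phi> x \<in> \<phi> ` (- U)" for x
    using in_closed_iff_infdist_zero[OF compact_imp_closed[OF c]] False by auto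
  moreover have "inj \<phi>"
    by (rule injI, rule torus_char_axis_eqD) (simp add: \<phi>_def vec_eq_iff)
  ultimately have "infdist (\<phi> x) (\<phi> ` (- U)) = 0 \<longleftrightarrow> x \<notin> U" for x
    by (simp add: inj_image_mem_iff)
  moreover have "continuous_on UNIV (\<lambda>x. infdist (\<phi> x) (\<phi> ` (- U)))"
    by (intro continuous_intros \<phi>)
  ultimately show ?thesis
    using that infdist_nonneg by blast
qed

text \<open>For open \<open>U\<close> the continuous functions \<open>min 1 (k * d)\<close> tend to
  the indicator of \<open>U\<close>, so dominated convergence gives equality on open sets. These
  form an intersection-stable generator of the Borel algebra.\<close>

lemma torus_measure_eqI_continuous:
  fixes M N :: "'n::finite torus measure"
  assumes fin: "finite_measure M" "finite_measure N" and sets: "sets M = sets borel" "sets N = sets borel"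
    and eq: "\<And>f :: 'n torus \<Rightarrow> real. continuous_on UNIV f \<Longrightarrow> (LINT x|M. f x) = (LINT x|N. f x)"
  shows "M = N"
proof (rule measure_eqI_generator_eq)
  show "Int_stable (Collect open :: 'n torus set set)"
    by (auto simp: Int_stable_def)
  show "sets M = sigma_sets UNIV (Collect open)" "sets N = sigma_sets UNIV (Collect open)"
    using sets by (simp_all add: borel_def)
  show "range (\<lambda>i::nat. UNIV) \<subseteq> Collect (open :: 'n torus set \<Rightarrow> bool)" "(\<Union>i::nat. UNIV) = (UNIV :: 'n torus set)"
    by auto
  show "emeasure M UNIV \<noteq> \<infinity>"
    using finite_measure.emeasure_finite[OF fin(1)] by simp
  fix U :: "'n torus set" assume "U \<in> Collect open"
  then have "open U" by simp
  obtain d :: "'n torus \<Rightarrow> real" where d: "continuous_on UNIV d" "\<And>x. 0 \<le> d x" "\<And>x. d x = 0 \<longleftrightarrow> x \<notin> U"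
    using torus_open_continuous_approx[OF \<open>open U\<close>] by blast
  have cont: "continuous_on UNIV (\<lambda>x. min 1 (real k * d x))" for k
    by (intro continuous_intros d(1))
  have lim: "(\<lambda>k. LINT x|L. min 1 (real k * d x)) \<longlonglongrightarrow> measure L U"
    if L: "finite_measure L" "sets L = sets borel" for L
  proof -
    interpret finite_measure L by fact
    have m: "f \<in> borel_measurable L" if "continuous_on UNIV f" for f :: "'n torus \<Rightarrow> real"
      using borel_measurable_continuous_onI[OF that] measurable_cong_sets[OF L(2)] by blast
    have U: "U \<in> sets L" using L(2) \<open>open U\<close> by simp
    have "(\<lambda>k. LINT x|L. min 1 (real k * d x)) \<longlonglongrightarrow> (LINT x|L. indicator U x)"
    proof (rule integral_dominated_convergence[where w = "\<lambda>_. 1"])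
      show "AE x in L. (\<lambda>k. min 1 (real k * d x)) \<longlonglongrightarrow> indicator U x"
      proof (rule AE_I2)
        fix x
        show "(\<lambda>k. min 1 (real k * d x)) \<longlonglongrightarrow> indicator U x"
        proof (cases "x \<in> U")
          case True
          then have pos: "0 < d x" using d(2,3)[of x] by (simp add: less_le)
          have "1 \<le> real k * d x" if "k \<ge> nat \<lceil>1 / d x\<rceil>" for k
          proof -
            have "1 / d x \<le> real k" using that by linarith
            then show ?thesis using pos by (simp add: field_simps)
          qed
          then have "\<forall>\<^sub>F k in sequentially. min 1 (real k * d x) = 1"
            by (intro eventually_sequentiallyI[of "nat \<lceil>1 / d x\<rceil>"]) auto
          then show ?thesis using True by (simp add: tendsto_eventually)
        next
          case False
          then show ?thesis using d(3)[of x] by simp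
        qed
      qed
      show "AE x in L. norm (min 1 (real k * d x)) \<le> 1" for k
        using d(2) by (intro AE_I2) (auto simp: min_def)
      show "(indicator U :: _ \<Rightarrow> real) \<in> borel_measurable L" using U by simp
    qed (auto intro: m cont)
    then show ?thesis using U by (simp add: sets.sets_into_space Int_absorb2)
  qed
  have "measure M U = measure N U"
    using LIMSEQ_unique[OF lim[OF fin(1) sets(1)]] lim[OF fin(2) sets(2)] eq[OF cont] by simp
  then show "emeasure M U = emeasure N U"
    using fin by (simp add: finite_measure.emeasure_eq_measure)
qed auto

lemma integrable_continuous_torus:
  fixes f :: "'n::finite torus \<Rightarrow> 'b::{banach, second_countable_topology}"
  assumes "finite_measure M" "sets M = sets borel" "continuous_on UNIV f"
  shows "integrable M f"
proof -
  obtain B where "\<And>x. norm (f x) \<le> B" using bounded_continuous_torus[OF assms(3)] by blast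
  then show ?thesis
    using borel_measurable_continuous_onI[OF assms(3)] measurable_cong_sets[OF assms(2)]
    by (intro finite_measure.integrable_const_bound[OF assms(1), of f B] AE_I2) auto
qed

text \<open>Linearity extends the equality to trigonometric polynomials, and uniform approximation
  extends it to continuous functions, with an error controlled by the total masses.\<close>

lemma torus_measure_eqI_char:
  fixes M N :: "'n::finite torus measure"
  assumes fin: "finite_measure M" "finite_measure N" and sets: "sets M = sets borel" "sets N = sets borel"
    and eq: "\<And>\<xi>. (LINT x|M. torus_char \<xi> x) = (LINT x|N. torus_char \<xi> x)"
  shows "M = N"
proof (rule torus_measure_eqI_continuous[OF fin sets])
  have int: "integrable M f" "integrable N f" if "continuous_on UNIV f"
    for f :: "'n torus \<Rightarrow> 'b::{banach, second_countable_topology}"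
    using integrable_continuous_torus[OF fin(1) sets(1) that] integrable_continuous_torus[OF fin(2) sets(2) that] .
  have trig: "(LINT x|M. g x) = (LINT x|N. g x)" if "trig_poly g" for g :: "'n torus \<Rightarrow> real"
    using that
  proof induction
    case (char c \<xi>)
    have "(LINT x|L. Re (c * torus_char \<xi> x)) = Re (c * (LINT x|L. torus_char \<xi> x))"
      if "integrable L (torus_char \<xi>)" for L
      using that by (simp add: integral_Re)
    then show ?case
      using int[OF continuous_on_torus_char] eq by simp
  next
    case (add f g)
    then show ?case
      using int[OF continuous_on_trig_poly] by simp
  qed
  fix f :: "'n torus \<Rightarrow> real" assume f: "continuous_on UNIV f"
  define K where "K = measure M UNIV + measure N UNIV"
  have close: "\<bar>(LINT x|M. f x) - (LINT x|N. f x)\<bar> \<le> e * K" if e: "0 < e" for e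
  proof -
    obtain g where g: "trig_poly g" "\<And>x. \<bar>f x - g x\<bar> < e"
      using trig_poly_dense[OF f e] by blast
    have b: "\<bar>(LINT x|L. f x) - (LINT x|L. g x)\<bar> \<le> e * measure L UNIV"
      if L: "finite_measure L" "sets L = sets borel" for L
    proof -
      interpret finite_measure L by fact
      have i: "integrable L f" "integrable L g"
        using integrable_continuous_torus[OF L] f continuous_on_trig_poly[OF g(1)] by blast+
      have "\<bar>(LINT x|L. f x) - (LINT x|L. g x)\<bar> = norm (LINT x|L. f x - g x)"
        using i by simp
      also have "\<dots> \<le> (LINT x|L. norm (f x - g x))"
        by (rule integral_norm_bound)
      also have "\<dots> \<le> (LINT x|L. e)"
        using i g(2) by (intro integral_mono) (auto intro: less_imp_le)
      also have "\<dots> = e * measure L UNIV"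
        using sets_eq_imp_space_eq[OF L(2)] by simp
      finally show ?thesis .
    qed
    show ?thesis
      using b[OF fin(1) sets(1)] b[OF fin(2) sets(2)] trig[OF g(1)]
      by (simp add: K_def distrib_left)
  qed
  show "(LINT x|M. f x) = (LINT x|N. f x)"
  proof (rule ccontr)
    assume "(LINT x|M. f x) \<noteq> (LINT x|N. f x)"
    then have pos: "0 < \<bar>(LINT x|M. f x) - (LINT x|N. f x)\<bar>" (is "0 < ?D") by simp
    have K: "0 \<le> K" by (simp add: K_def)
    \<comment> \<open>This choice of \<open>e\<close> makes \<open>e * K\<close> smaller than
      \<open>?D\<close>; the added \<open>1\<close> covers \<open>K = 0\<close>.\<close>
    have "?D \<le> ?D / (2 * (K + 1)) * K"
      using close[of "?D / (2 * (K + 1))"] pos K by simp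
    also have "\<dots> < ?D"
      using pos K by (simp add: field_simps mult_nonneg_nonneg add_strict_increasing)
    finally show False by simp
  qed
qed

subsection \<open>The triangle inequality in L2\<close>

text \<open>The integral of \<open>(f x + t * g x)\<close> squared is a quadratic polynomial in
  \<open>t\<close> without negative values. This gives the Cauchy-Schwarz inequality, and with it
  the triangle inequality.\<close>

lemma L2_triangle:
  fixes f g :: "'a \<Rightarrow> real"
  assumes [measurable]: "f \<in> borel_measurable M" "g \<in> borel_measurable M"
    and int: "integrable M (\<lambda>x. (f x)\<^sup>2)" "integrable M (\<lambda>x. (g x)\<^sup>2)"
  shows "sqrt (LINT x|M. (f x + g x)\<^sup>2) \<le> sqrt (LINT x|M. (f x)\<^sup>2) + sqrt (LINT x|M. (g x)\<^sup>2)"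
proof -
  define A B C where "A = (LINT x|M. (f x)\<^sup>2)" and "B = (LINT x|M. (g x)\<^sup>2)" and "C = (LINT x|M. f x * g x)"
  have fg: "integrable M (\<lambda>x. f x * g x)"
  proof (rule Bochner_Integration.integrable_bound)
    show "integrable M (\<lambda>x. (f x)\<^sup>2 + (g x)\<^sup>2)" using int by simp
    have "\<bar>a * b\<bar> \<le> a\<^sup>2 + b\<^sup>2" for a b :: real
      using sum_squares_bound[of "\<bar>a\<bar>" "\<bar>b\<bar>"] abs_ge_zero[of "a * b"]
      unfolding abs_mult power2_abs by linarith
    then show "AE x in M. norm (f x * g x) \<le> norm ((f x)\<^sup>2 + (g x)\<^sup>2)" by simp
  qed measurable
  have sq: "(LINT x|M. (f x + t * g x)\<^sup>2) = A + 2 * t * C + t\<^sup>2 * B" for t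
  proof -
    have "(LINT x|M. (f x + t * g x)\<^sup>2) = (LINT x|M. (f x)\<^sup>2 + 2 * t * (f x * g x) + t\<^sup>2 * (g x)\<^sup>2)"
      by (intro Bochner_Integration.integral_cong) (auto simp: power2_eq_square algebra_simps)
    also have "\<dots> = A + 2 * t * C + t\<^sup>2 * B"
      using int fg by (simp add: A_def B_def C_def)
    finally show ?thesis .
  qed
  have nonneg: "0 \<le> A + 2 * t * C + t\<^sup>2 * B" for t
    unfolding sq[symmetric] by simp
  have AB: "0 \<le> A" "0 \<le> B" by (simp_all add: A_def B_def)
  have "C\<^sup>2 \<le> A * B"
  proof (cases "B = 0")
    case True
    have "C = 0"
    proof (rule ccontr)
      assume "C \<noteq> 0"
      \<comment> \<open>With \<open>B = 0\<close> the polynomial is affine, and this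
        \<open>t\<close> gives it the value \<open>-1\<close>.\<close>
      then show False using nonneg[of "- (A + 1) / (2 * C)"] True by (simp add: field_simps)
    qed
    then show ?thesis using True by simp
  next
    case False
    then have "0 < B" using AB by simp
    \<comment> \<open>The point \<open>- C / B\<close> minimises the quadratic polynomial.\<close>
    then show ?thesis
      using nonneg[of "- C / B"] by (simp add: field_simps power2_eq_square)
  qed
  then have "C \<le> sqrt (A * B)"
    by (rule real_le_rsqrt)
  then have "A + 2 * C + B \<le> (sqrt A + sqrt B)\<^sup>2"
    using AB by (simp add: power2_sum real_sqrt_mult)
  then have "sqrt (A + 2 * C + B) \<le> sqrt A + sqrt B"
    using AB by (intro real_le_lsqrt) auto
  then show ?thesis
    using sq[of 1] by (simp add: A_def B_def)
qed

subsection \<open>Convolution and Fourier coefficients\<close>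

context
  fixes h :: "'n::finite torus \<Rightarrow> real"
  assumes h: "continuous_on UNIV h"
begin

lemma borel_measurable_continuous_torus_diff:
  "(\<lambda>(x, y). h (x - y)) \<in> borel_measurable (borel \<Otimes>\<^sub>M borel)"
  by (rule borel_measurable_torus_diff[OF borel_measurable_continuous_onI[OF h]])

lemma borel_measurable_conv_measure:
  assumes "finite_measure M" "sets M = sets borel"
  shows "(\<lambda>x. LINT y|M. h (x - y)) \<in> borel_measurable borel"
proof -
  interpret finite_measure M by fact
  note [measurable_cong] = assms(2)
  note borel_measurable_continuous_torus_diff [measurable]
  show ?thesis by measurable
qed

lemma borel_measurable_torus_conv [measurable]: "torus_conv h \<mu> \<in> borel_measurable borel"
  unfolding torus_conv_def signed_integral_def
  by (intro borel_measurable_diff borel_measurable_conv_measure)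
    (auto simp: finite_measure_pos_part finite_measure_neg_part)

lemma bounded_conv_measure:
  assumes M: "finite_measure M" "sets M = sets borel"
  shows "\<exists>K. \<forall>x. \<bar>LINT y|M. h (x - y)\<bar> \<le> K"
proof -
  obtain B where B: "\<And>x. \<bar>h x\<bar> \<le> B"
    using bounded_continuous_torus[OF h] by auto
  interpret finite_measure M by fact
  have "\<bar>LINT y|M. h (x - y)\<bar> \<le> (LINT y|M. B)" for x
  proof -
    have "integrable M (\<lambda>y. h (x - y))"
      by (intro integrable_continuous_torus M continuous_on_torus_diff h)
    then have "(LINT y|M. \<bar>h (x - y)\<bar>) \<le> (LINT y|M. B)"
      using B by (intro integral_mono) auto
    then show ?thesis
      using integral_norm_bound[of M "\<lambda>y. h (x - y)"] unfolding real_norm_def by (rule order_trans[rotated])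
  qed
  then show ?thesis by blast
qed

lemma bounded_torus_conv: "\<exists>K. \<forall>x. \<bar>torus_conv h \<mu> x\<bar> \<le> K"
proof -
  obtain K L where "\<And>x. \<bar>LINT y|pos_part \<mu>. h (x - y)\<bar> \<le> K" "\<And>x. \<bar>LINT y|neg_part \<mu>. h (x - y)\<bar> \<le> L"
    using bounded_conv_measure[OF finite_measure_pos_part sets_pos_part, of \<mu>]
      bounded_conv_measure[OF finite_measure_neg_part sets_neg_part, of \<mu>] by blast
  then have "\<bar>torus_conv h \<mu> x\<bar> \<le> K + L" for x
    unfolding torus_conv_def signed_integral_def
    by (intro order_trans[OF abs_triangle_ineq4] add_mono)
  then show ?thesis by blast
qed

lemma integrable_torus_conv_square: "integrable torus_measure (\<lambda>x. (torus_conv h \<mu> x)\<^sup>2)"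
proof -
  obtain K where K: "\<And>x. \<bar>torus_conv h \<mu> x\<bar> \<le> K" using bounded_torus_conv by blast
  show ?thesis
    using power_mono[OF K abs_ge_zero, of _ 2]
    by (intro finite_measure.integrable_const_bound[OF finite_measure_torus, where B = "K\<^sup>2"] AE_I2) auto
qed

lemma torus_conv_add: "torus_conv h (\<mu> + \<nu>) x = torus_conv h \<mu> x + torus_conv h \<nu> x"
proof -
  have "continuous_on UNIV (\<lambda>y. h (x - y))" by (rule continuous_on_torus_diff[OF h])
  moreover from bounded_continuous_torus[OF this] obtain B where "\<And>y. \<bar>h (x - y)\<bar> \<le> B" by auto
  ultimately show ?thesis
    unfolding torus_conv_def by (intro signed_integral_add borel_measurable_continuous_onI)
qed

lemma torus_conv_scaleR: "torus_conv h (c *\<^sub>R \<mu>) x = c * torus_conv h \<mu> x"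
proof -
  have "continuous_on UNIV (\<lambda>y. h (x - y))" by (rule continuous_on_torus_diff[OF h])
  moreover from bounded_continuous_torus[OF this] obtain B where "\<And>y. \<bar>h (x - y)\<bar> \<le> B" by auto
  ultimately show ?thesis
    unfolding torus_conv_def by (intro signed_integral_scaleR borel_measurable_continuous_onI)
qed

lemma fourier_translate:
  "(LINT x|torus_measure. torus_char \<xi> x * of_real (h (x - y))) = torus_char \<xi> y * fourier_coeff h \<xi>"
proof -
  note borel_measurable_continuous_onI[OF h, measurable]
  have "torus_char \<xi> x = torus_char \<xi> y * torus_char \<xi> (x - y)" for x
    by (simp flip: torus_char_add_arg)
  then have "(LINT x|torus_measure. torus_char \<xi> x * of_real (h (x - y))) =
      (LINT x|torus_measure. torus_char \<xi> y * (torus_char \<xi> (x - y) * of_real (h (x - y))))"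
    by (metis (no_types, opaque_lifting) mult.assoc)
  also have "\<dots> = torus_char \<xi> y * (LINT x|torus_measure. torus_char \<xi> (x - y) * of_real (h (x - y)))"
    by simp
  also have "(LINT x|torus_measure. torus_char \<xi> (x - y) * of_real (h (x - y))) =
      (LINT x|torus_measure. torus_char \<xi> x * of_real (h x))"
    by (rule integral_torus_translate[where f = "\<lambda>x. torus_char \<xi> x * of_real (h x)"]) measurable
  finally show ?thesis by (simp add: fourier_coeff_def)
qed

text \<open>Fubini applies because the integrand is bounded and the product measure is finite. The
  inner integral over \<open>x\<close> is then the coefficient of a translate of
  \<open>h\<close>.\<close>

lemma fourier_conv_measure:
  assumes M: "finite_measure M" "sets M = sets borel"
  shows "(LINT x|torus_measure. torus_char \<xi> x * of_real (LINT y|M. h (x - y))) =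
    fourier_coeff h \<xi> * (LINT y|M. torus_char \<xi> y)"
proof -
  interpret M: finite_measure M by fact
  interpret T: finite_measure torus_measure by (rule finite_measure_torus)
  interpret pair_sigma_finite torus_measure M ..
  interpret P: finite_measure "torus_measure \<Otimes>\<^sub>M M"
    by (intro finite_measure_pair_measure finite_measure_torus M)
  note [measurable_cong] = M(2)
  note borel_measurable_continuous_torus_diff [measurable]
  obtain B where B: "\<And>x. \<bar>h x\<bar> \<le> B"
    using bounded_continuous_torus[OF h] by auto
  have "integrable (torus_measure \<Otimes>\<^sub>M M) (\<lambda>(x, y). torus_char \<xi> x * of_real (h (x - y)))"
    by (rule P.integrable_const_bound[where B = B]) (auto simp: norm_mult B)
  from Fubini_integral[OF this] have "(LINT x|torus_measure. LINT y|M. torus_char \<xi> x * of_real (h (x - y))) =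
      (LINT y|M. LINT x|torus_measure. torus_char \<xi> x * of_real (h (x - y)))" ..
  then show ?thesis by (simp add: fourier_translate mult.commute)
qed

text \<open>The difference on the right is the Fourier coefficient of \<open>\<mu>\<close>, so this
  is the product rule for convolution.\<close>

lemma fourier_torus_conv:
  "(LINT x|torus_measure. torus_char \<xi> x * of_real (torus_conv h \<mu> x)) =
    fourier_coeff h \<xi> * ((LINT y|pos_part \<mu>. torus_char \<xi> y) - (LINT y|neg_part \<mu>. torus_char \<xi> y))"
proof -
  interpret T: finite_measure torus_measure by (rule finite_measure_torus)
  have int: "integrable torus_measure (\<lambda>x. torus_char \<xi> x * of_real (LINT y|M. h (x - y)))"
    if M: "finite_measure M" "sets M = sets borel" for M
  proof -
    interpret M: finite_measure M by fact
    note borel_measurable_conv_measure[OF M, measurable]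
    obtain K where K: "\<And>x. \<bar>LINT y|M. h (x - y)\<bar> \<le> K"
      using bounded_conv_measure[OF M] by blast
    show ?thesis
      by (intro T.integrable_const_bound[where B = K] AE_I2) (auto simp: norm_mult K)
  qed
  show ?thesis
    unfolding torus_conv_def signed_integral_def of_real_diff right_diff_distrib
    using int[OF finite_measure_pos_part[of \<mu>] sets_pos_part] int[OF finite_measure_neg_part[of \<mu>] sets_neg_part]
    by (simp add: fourier_conv_measure finite_measure_pos_part finite_measure_neg_part)
qed

subsection \<open>The seminorm properties\<close>

lemma conv_norm_nonneg: "0 \<le> conv_norm h \<mu>"
  by (simp add: conv_norm_def torus_L2_norm_def)

lemma conv_norm_scaleR: "conv_norm h (c *\<^sub>R \<mu>) = \<bar>c\<bar> * conv_norm h \<mu>"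
  by (simp add: conv_norm_def torus_L2_norm_def torus_conv_scaleR power_mult_distrib real_sqrt_mult)

lemma conv_norm_add: "conv_norm h (\<mu> + \<nu>) \<le> conv_norm h \<mu> + conv_norm h \<nu>"
  unfolding conv_norm_def torus_L2_norm_def torus_conv_add
  by (rule L2_triangle[OF _ _ integrable_torus_conv_square integrable_torus_conv_square]) simp_all

text \<open>Definiteness is the only axiom in question; the value at \<open>0\<close> comes from
  homogeneity with scalar \<open>0\<close>.\<close>

lemma is_norm_conv_norm_iff: "is_norm (conv_norm h) \<longleftrightarrow> (\<forall>\<mu>. conv_norm h \<mu> = 0 \<longrightarrow> \<mu> = 0)"
proof -
  have "conv_norm h 0 = 0"
    using conv_norm_scaleR[of 0 0] by simp
  then show ?thesis
    unfolding is_norm_def using conv_norm_nonneg conv_norm_scaleR conv_norm_add by metis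
qed

section \<open>The two directions of the equivalence\<close>

lemma conv_norm_eq_0D:
  assumes "conv_norm h \<mu> = 0" "\<And>\<xi>. fourier_coeff h \<xi> \<noteq> 0"
  shows "\<mu> = 0"
proof -
  have "(LINT x|torus_measure. (torus_conv h \<mu> x)\<^sup>2) = 0"
    using assms(1) by (simp add: conv_norm_def torus_L2_norm_def)
  then have "AE x in torus_measure. torus_conv h \<mu> x = 0"
    using integral_nonneg_eq_0_iff_AE[OF integrable_torus_conv_square] by simp
  then have "AE x in torus_measure. torus_char \<xi> x * of_real (torus_conv h \<mu> x) = 0" for \<xi>
    by eventually_elim simp
  then have "(LINT x|torus_measure. torus_char \<xi> x * of_real (torus_conv h \<mu> x)) = 0" for \<xi>
    by (rule integral_eq_zero_AE)
  \<comment> \<open>In the product rule the nonzero coefficient of \<open>h\<close> cancels, so both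
    Jordan parts have the same coefficients.\<close>
  then have "pos_part \<mu> = neg_part \<mu>"
    using assms(2) by (intro torus_measure_eqI_char finite_measure_pos_part finite_measure_neg_part)
      (simp_all add: fourier_torus_conv)
  \<comment> \<open>Outside the Borel sets the value is \<open>0\<close> by the convention in the
    type.\<close>
  then have "sm_value \<mu> A = 0" for A
    using jordan_decomposition[of A \<mu>] sm_value_not_borel[of A \<mu>] by (cases "A \<in> sets borel") auto
  then show ?thesis
    by (simp add: sm_value_inject[symmetric] zero_signed_measure.rep_eq fun_eq_iff)
qed

lemma fourier_coeff_nonzero:
  assumes inj: "\<And>\<mu>. conv_norm h \<mu> = 0 \<Longrightarrow> \<mu> = 0"
  shows "fourier_coeff h \<xi> \<noteq> 0"
proof
  assume zero: "fourier_coeff h \<xi> = 0"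
  \<comment> \<open>The substitution of \<open>x - y\<close> for \<open>y\<close> turns the integral
    into \<open>torus_char \<xi> x\<close> times the conjugate of
    \<open>fourier_coeff h \<xi>\<close>; the conjugate arises because \<open>h\<close> is
    real.\<close>
  have orth: "(LINT y|torus_measure. torus_char \<xi> y * of_real (h (x - y))) = 0" for x
  proof -
    have "(LINT y|torus_measure. torus_char \<xi> (x - y) * of_real (h (x - (x - y)))) =
        (LINT y|torus_measure. torus_char \<xi> y * of_real (h (x - y)))"
    proof (rule integral_torus_reflect[where f = "\<lambda>y. torus_char \<xi> y * of_real (h (x - y))"])
      have [measurable]: "(\<lambda>y. h (x - y)) \<in> borel_measurable borel"
        by (intro borel_measurable_continuous_onI continuous_on_torus_diff h)
      show "(\<lambda>y. torus_char \<xi> y * of_real (h (x - y))) \<in> borel_measurable borel" by measurable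
    qed
    also have "(LINT y|torus_measure. torus_char \<xi> (x - y) * of_real (h (x - (x - y)))) =
        (LINT y|torus_measure. torus_char \<xi> x * cnj (torus_char \<xi> y * of_real (h y)))"
      by (simp add: torus_char_diff_arg mult.assoc)
    also have "\<dots> = torus_char \<xi> x * cnj (fourier_coeff h \<xi>)"
      by (simp add: fourier_coeff_def del: complex_cnj_mult)
    finally show ?thesis using zero by simp
  qed
  \<comment> \<open>The values \<open>c = 1\<close> and \<open>c = \<i>\<close> give, up to sign,
    the real and the imaginary part of the character as densities.\<close>
  have sq: "(LINT x|torus_measure. (Re (c * torus_char \<xi> x))\<^sup>2) = 0" if c: "norm c = 1" for c
  proof -
    let ?g = "\<lambda>x. Re (c * torus_char \<xi> x)"
    have g: "?g \<in> borel_measurable borel" "\<bar>?g x\<bar> \<le> 1" for x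
      using abs_Re_le_cmod[of "c * torus_char \<xi> x"] c by (auto simp: norm_mult)
    obtain \<mu> where \<mu>: "signed_integral \<mu> f = (LINT x|torus_measure. ?g x * f x)"
      if "f \<in> borel_measurable borel" "\<And>x. \<bar>f x\<bar> \<le> B" for f B
      using signed_measure_of_density[OF finite_measure_torus sets_torus_measure g] by metis
    have "torus_conv h \<mu> x = 0" for x
    proof -
      have cont: "continuous_on UNIV (\<lambda>y. h (x - y))" by (rule continuous_on_torus_diff[OF h])
      from bounded_continuous_torus[OF this] obtain B where B: "\<And>y. \<bar>h (x - y)\<bar> \<le> B" by auto
      have int: "integrable torus_measure (\<lambda>y. torus_char \<xi> y * of_real (h (x - y)))"
        by (intro integrable_continuous_torus finite_measure_torus sets_torus_measure continuous_intros
            continuous_on_torus_char cont)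
      have "torus_conv h \<mu> x = (LINT y|torus_measure. ?g y * h (x - y))"
        unfolding torus_conv_def by (rule \<mu>[OF borel_measurable_continuous_onI[OF cont] B])
      also have "\<dots> = (LINT y|torus_measure. Re (c * (torus_char \<xi> y * of_real (h (x - y)))))"
        by (intro Bochner_Integration.integral_cong) (auto simp: algebra_simps)
      also have "\<dots> = Re (LINT y|torus_measure. c * (torus_char \<xi> y * of_real (h (x - y))))"
        using int by (intro integral_Re) simp
      also have "\<dots> = 0"
        using orth by simp
      finally show ?thesis .
    qed
    then have "conv_norm h \<mu> = 0"
      by (simp add: conv_norm_def torus_L2_norm_def)
    then have "\<mu> = 0" by (rule inj)
    \<comment> \<open>Integrating the density against its own measure produces the integral of its
      square.\<close>
    then have "signed_integral \<mu> ?g = 0"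
      using signed_integral_scaleR[OF g, of 0 \<mu>] by simp
    then show ?thesis
      using \<mu>[OF g] by (simp add: power2_eq_square)
  qed
  have int: "integrable torus_measure (\<lambda>x. (Re (c * torus_char \<xi> x))\<^sup>2)" for c
    by (intro integrable_continuous_torus finite_measure_torus sets_torus_measure continuous_intros
        continuous_on_torus_char)
  \<comment> \<open>The two squares add up to the squared modulus of the character, whose integral
    is the total mass \<open>1\<close>, while each square integrates to \<open>0\<close>.\<close>
  have "(Re (1 * torus_char \<xi> x))\<^sup>2 + (Re (\<i> * torus_char \<xi> x))\<^sup>2 = 1" for x
    using cmod_power2[of "torus_char \<xi> x"] by simp
  then have "(LINT x|torus_measure. (Re (1 * torus_char \<xi> x))\<^sup>2 + (Re (\<i> * torus_char \<xi> x))\<^sup>2) =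
      measure (torus_measure :: 'n torus measure) UNIV"
    by simp
  also have "\<dots> = 1"
    by (simp add: measure_def emeasure_torus_measure_UNIV)
  finally show False
    using int[of 1] int[of \<i>] sq[of 1] sq[of \<i>] by simp
qed

end

theorem proposition2:
  fixes h :: "'n::finite torus \<Rightarrow> real"
  assumes "continuous_on UNIV h"
  shows "is_norm (conv_norm h) \<longleftrightarrow> (\<forall>\<xi> :: int ^ 'n. fourier_coeff h \<xi> \<noteq> 0)"
  unfolding is_norm_conv_norm_iff[OF assms]
  using conv_norm_eq_0D[OF assms] fourier_coeff_nonzero[OF assms] by metis

end
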